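(* Let $\mathcal{C}$ be a finite prevariety over a finite alphabet $A$ with canonical $\mathcal{C}$-morphism $\eta_{\mathcal{C}}:A^*\to N_{\mathcal{C}}$, and let $\rho:2^{A^*}\to R$ be a nice multiplicative rating map. Then the set $\mathcal{P}=\{(t,r)\in N_{\mathcal{C}}\times R \mid r\in \mathcal{I}_{\mathit{SF}(\mathcal{C})}[\eta_{\mathcal{C}}^{-1}(t),\rho]\}$ is the least subset of $N_{\mathcal{C}}\times R$ that is $\mathit{SF}$-saturated for $\eta_{\mathcal{C}}$ and $\rho$.
   Context: Fix a finite alphabet $A$. A lattice is a class of languages containing $\emptyset,A^*$ and closed under union and intersection. A prevariety is a lattice of regular languages closed under complement and under quotients $u^{-1}L=\{w\mid uw\in L\}$, $Lu^{-1}=\{w\mid wu\in L\}$. $\mathit{SF}(\mathcal{C})$ is the least class containing $\mathcal{C}$ and all $\{a\}$ ($a\in A$), closed under union, complement and concatenation. A $\mathcal{C}$-morphism is a surjective monoid morphism $\eta:A^*\to N$ onto a finite monoid such that every language $\eta^{-1}(F)$, $F\subseteq N$, belongs to $\mathcal{C}$. When $\mathcal{C}$ is a finite prevariety, there is a $\mathcal{C}$-morphism $\eta_{\mathcal{C}}:A^*\to N_{\mathcal{C}}$ recognizing every language of $\mathcal{C}$, unique up to isomorphism: the canonical $\mathcal{C}$-morphism. A rating algebra is a finite commutative idempotent monoid $(R,+)$ with neutral element $0_R$, ordered by $r\le s$ iff $r+s=s$. A rating map is a map $\rho:2^{A^*}\to R$ with $\rho(\emptyset)=0_R$ and $\rho(K_1\cup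 K_2)=\rho(K_1)+\rho(K_2)$. It is nice if for every $K\subseteq A^*$ there is a finite $F\subseteq K$ with $\rho(K)=\rho(F)$. It is multiplicative if $R$ carries a multiplication making $(R,+,\cdot)$ an idempotent semiring (with $0_R$ absorbing and multiplication distributing over $+$) and $\rho(\{\varepsilon\})=1_R$, $\rho(K_1K_2)=\rho(K_1)\rho(K_2)$. Write $\rho(w)$ for $\rho(\{w\})$. For $r\in R$, $\omega$ is a positive integer such that $r^\omega$ is multiplicatively idempotent for all $r\in R$. A cover of $L$ is a finite set $\mathbf{K}$ of languages with $L\subseteq\bigcup\mathbf{K}$; it is a $\mathcal{D}$-cover if all members are in $\mathcal{D}$. Its $\rho$-imprint is $\{r\in R\mid \exists K\in\mathbf{K},\ r\le\rho(K)\}$. For a lattice $\mathcal{D}$ there exists a $\mathcal{D}$-cover of $L$ whose $\rho$-imprint is included in the $\rho$-imprint of every $\mathcal{D}$-cover of $L$; this imprint is denoted $\mathcal{I}_{\mathcal{D}}[L,\rho]$. For a morphism $\eta:A^*\to N$ into a finite monoid and a multiplicative rating map $\rho:2^{A^*}\to R$, a set $S\subseteq N\times R$ is $\mathit{SF}$-saturated for $\eta$ and $\rho$ if: (1) $(\eta(w),\rho(w))\in S$ for every $w\in A^*$; (2) if $(t,r)\in S$ and $q\le r$ then $(t,q)\in S$; (3) if $(s,q),(t,r)\in S$ then $(st,qr)\in S$; (4) if $(e,r)\in S$ and $e$ is idempotent in $N$, then $(e,r^\omega+r^{\omega+1})\in S$. *)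

theory Defs
  imports Main
begin

text \<open>Alphabet: a finite type 'a (A = UNIV). Words: 'a list. Languages: 'a list set.\<close>

definition conc :: "'a list set \<Rightarrow> 'a list set \<Rightarrow> 'a list set" where
  "conc K L = {u @ v | u v. u \<in> K \<and> v \<in> L}"

inductive_set star :: "'a list set \<Rightarrow> 'a list set" for L where
  star_nil: "[] \<in> star L"
| star_app: "u \<in> L \<Longrightarrow> v \<in> star L \<Longrightarrow> u @ v \<in> star L"

inductive_set regular :: "'a list set set" where
  reg_empty: "{} \<in> regular"
| reg_eps: "{[]} \<in> regular"
| reg_letter: "{[a]} \<in> regular"
| reg_union: "K \<in> regular \<Longrightarrow> L \<in> regular \<Longrightarrow> K \<union> L \<in> regular"
| reg_conc: "K \<in> regular \<Longrightarrow> L \<in> regular \<Longrightarrow> conc K L \<in> regular"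
| reg_star: "L \<in> regular \<Longrightarrow> star L \<in> regular"

definition lattice :: "'a list set set \<Rightarrow> bool" where
  "lattice D \<longleftrightarrow> {} \<in> D \<and> UNIV \<in> D \<and>
     (\<forall>K\<in>D. \<forall>L\<in>D. K \<union> L \<in> D \<and> K \<inter> L \<in> D)"

definition prevariety :: "'a list set set \<Rightarrow> bool" where
  "prevariety C \<longleftrightarrow> lattice C \<and> C \<subseteq> regular \<and>
     (\<forall>L\<in>C. - L \<in> C) \<and>
     (\<forall>L\<in>C. \<forall>u. {w. u @ w \<in> L} \<in> C \<and> {w. w @ u \<in> L} \<in> C)"

inductive_set SF :: "'a list set set \<Rightarrow> 'a list set set" for C where
  SF_base: "L \<in> C \<Longrightarrow> L \<in> SF C"
| SF_letter: "{[a]} \<in> SF C"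
| SF_union: "K \<in> SF C \<Longrightarrow> L \<in> SF C \<Longrightarrow> K \<union> L \<in> SF C"
| SF_compl: "L \<in> SF C \<Longrightarrow> - L \<in> SF C"
| SF_conc: "K \<in> SF C \<Longrightarrow> L \<in> SF C \<Longrightarrow> conc K L \<in> SF C"

definition monoid_morphism :: "('a list \<Rightarrow> 'n::monoid_mult) \<Rightarrow> bool" where
  "monoid_morphism \<eta> \<longleftrightarrow> \<eta> [] = 1 \<and> (\<forall>u v. \<eta> (u @ v) = \<eta> u * \<eta> v)"

definition C_morphism :: "'a list set set \<Rightarrow> ('a list \<Rightarrow> 'n::{monoid_mult,finite}) \<Rightarrow> bool" where
  "C_morphism C \<eta> \<longleftrightarrow> surj \<eta> \<and> monoid_morphism \<eta> \<and> (\<forall>F. \<eta> -` F \<in> C)"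

text \<open>Canonical C-morphism: a C-morphism recognizing every language of C
  (unique up to isomorphism).\<close>
definition canonical_C_morphism :: "'a list set set \<Rightarrow> ('a list \<Rightarrow> 'n::{monoid_mult,finite}) \<Rightarrow> bool" where
  "canonical_C_morphism C \<eta> \<longleftrightarrow> C_morphism C \<eta> \<and> (\<forall>L\<in>C. \<exists>F. L = \<eta> -` F)"

definition rle :: "'r::plus \<Rightarrow> 'r \<Rightarrow> bool" where
  "rle r s \<longleftrightarrow> r + s = s"

text \<open>Rating maps into a finite idempotent semiring ('r with class semiring_0 and monoid_mult:
  commutative additive monoid with 0, associative multiplication with unit 1,
  distributivity, 0 absorbing); additive idempotency is required explicitly.\<close>
definition rating_map :: "('a list set \<Rightarrow> 'r::{comm_monoid_add,finite}) \<Rightarrow> bool" where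
  "rating_map \<rho> \<longleftrightarrow> (\<forall>r::'r. r + r = r) \<and> \<rho> {} = 0 \<and>
     (\<forall>K1 K2. \<rho> (K1 \<union> K2) = \<rho> K1 + \<rho> K2)"

definition nice :: "('a list set \<Rightarrow> 'r::{comm_monoid_add,finite}) \<Rightarrow> bool" where
  "nice \<rho> \<longleftrightarrow> (\<forall>K. \<exists>F. finite F \<and> F \<subseteq> K \<and> \<rho> K = \<rho> F)"

definition multiplicative_rating_map ::
  "('a list set \<Rightarrow> 'r::{semiring_0,monoid_mult,finite}) \<Rightarrow> bool" where
  "multiplicative_rating_map \<rho> \<longleftrightarrow> rating_map \<rho> \<and> \<rho> {[]} = 1 \<and>
     (\<forall>K1 K2. \<rho> (conc K1 K2) = \<rho> K1 * \<rho> K2)"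

definition is_cover :: "'a list set \<Rightarrow> 'a list set set \<Rightarrow> bool" where
  "is_cover L KK \<longleftrightarrow> finite KK \<and> L \<subseteq> \<Union> KK"

definition is_D_cover :: "'a list set set \<Rightarrow> 'a list set \<Rightarrow> 'a list set set \<Rightarrow> bool" where
  "is_D_cover D L KK \<longleftrightarrow> is_cover L KK \<and> KK \<subseteq> D"

definition imprint :: "('a list set \<Rightarrow> 'r::plus) \<Rightarrow> 'a list set set \<Rightarrow> 'r set" where
  "imprint \<rho> KK = {r. \<exists>K\<in>KK. rle r (\<rho> K)}"

text \<open>I_D[L,rho]: the imprint of a D-cover of L whose imprint is included in the imprint
  of every D-cover of L (exists for lattices D).\<close>
definition opt_imprint :: "'a list set set \<Rightarrow> 'a list set \<Rightarrow> ('a list set \<Rightarrow> 'r::plus) \<Rightarrow> 'r set" where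
  "opt_imprint D L \<rho> = imprint \<rho> (SOME KK. is_D_cover D L KK \<and>
      (\<forall>KK'. is_D_cover D L KK' \<longrightarrow> imprint \<rho> KK \<subseteq> imprint \<rho> KK'))"

text \<open>SF-saturation, with \<omega> a fixed positive integer making every r^\<omega> idempotent.\<close>
definition SF_saturated :: "('a list \<Rightarrow> 'n::monoid_mult) \<Rightarrow> ('a list set \<Rightarrow> 'r::{semiring_0,monoid_mult})
    \<Rightarrow> nat \<Rightarrow> ('n \<times> 'r) set \<Rightarrow> bool" where
  "SF_saturated \<eta> \<rho> \<omega> S \<longleftrightarrow>
     (\<forall>w. (\<eta> w, \<rho> {w}) \<in> S) \<and>
     (\<forall>t r q. (t, r) \<in> S \<and> rle q r \<longrightarrow> (t, q) \<in> S) \<and>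
     (\<forall>s q t r. (s, q) \<in> S \<and> (t, r) \<in> S \<longrightarrow> (s * t, q * r) \<in> S) \<and>
     (\<forall>e r. (e, r) \<in> S \<and> e * e = e \<longrightarrow> (e, r ^ \<omega> + r ^ (\<omega> + 1)) \<in> S)"

definition least_SF_saturated :: "('a list \<Rightarrow> 'n::monoid_mult) \<Rightarrow> ('a list set \<Rightarrow> 'r::{semiring_0,monoid_mult})
    \<Rightarrow> nat \<Rightarrow> ('n \<times> 'r) set \<Rightarrow> bool" where
  "least_SF_saturated \<eta> \<rho> \<omega> P \<longleftrightarrow>
     SF_saturated \<eta> \<rho> \<omega> P \<and> (\<forall>S. SF_saturated \<eta> \<rho> \<omega> S \<longrightarrow> P \<subseteq> S)"

end

theory Submission
  imports Defs
begin

text \<open>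
  Saturation of the optimal imprints: the syntactic congruence of a finite family of languages of
  \<open>SF C\<close> has finitely many classes, all of them again in \<open>SF C\<close>, so that optimal imprints can be
  tested on classes. Classes multiply, and \<open>w\<^sup>n\<close> and \<open>w\<^sup>n\<^sup>+\<^sup>1\<close> are congruent
  for large \<open>n\<close> as soon as \<open>\<eta> w\<close> is idempotent.

  Minimality: more generally, let \<open>M\<close> be a finite ordered monoid with a projection \<open>\<pi>\<close> and an
  operation \<open>sharp\<close> bounding \<open>p\<^sup>\<omega>\<close> and \<open>p\<^sup>\<omega>\<^sup>+\<^sup>1\<close> when \<open>\<pi> p\<close> is idempotent; in the theorem
  \<open>M = N \<times> R\<close>. Let \<open>W\<close> be the closure of \<open>B \<subseteq> M\<close> under products and \<open>sharp\<close>. Words over \<open>B\<close> are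
  covered by finitely many languages, star-free over the right action of \<open>\<pi>\<close> on a set \<open>X \<subseteq> M\<close>,
  such that on \<open>X\<close> all products of words of one language are bounded by one element of \<open>W\<close>. The
  cover is built by induction on \<open>(|X|, |B|)\<close>, in the spirit of local divisors. If all letters
  permute \<open>X\<close>, the languages are the classes of words with the same action: elements of \<open>W\<close> acting
  trivially are bounded by their \<open>sharp\<close>, and so are finitely many of them by a product of such
  elements. If some letter \<open>c\<close> does not permute \<open>X\<close>, words are cut at the occurrences of \<open>c\<close>; the
  factors in between are words over \<open>B - {c}\<close>, and their bounds, multiplied by \<open>c\<close>, form a new
  alphabet acting on the smaller set \<open>X #> c\<close>.
\<close>

section \<open>Star-free closure\<close>

lemma concI: "u \<in> K \<Longrightarrow> v \<in> L \<Longrightarrow> u @ v \<in> conc K L"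
  unfolding conc_def by blast

lemma SF_inter:
  assumes "K \<in> SF C" and "L \<in> SF C"
  shows "K \<inter> L \<in> SF C"
proof -
  have "K \<inter> L = - (- K \<union> - L)" by blast
  then show ?thesis using assms by (metis SF_union SF_compl)
qed

lemma SF_UNIV: "{} \<in> C \<Longrightarrow> UNIV \<in> SF C"
  using SF_compl[OF SF_base, of "{}" C] by simp

lemma lattice_SF:
  assumes "{} \<in> C"
  shows "lattice (SF C)"
  using assms by (simp add: lattice_def SF_base SF_UNIV SF_union SF_inter)

lemma SF_UN:
  assumes "{} \<in> C" and "finite I" and "\<And>i. i \<in> I \<Longrightarrow> K i \<in> SF C"
  shows "(\<Union>i\<in>I. K i) \<in> SF C"
  using assms(2,3)
proof (induction I)
  case empty
  then show ?case by (simp add: SF_base[OF assms(1)])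
next
  case (insert i I)
  then show ?case by (simp add: SF_union)
qed

lemma SF_INT:
  assumes "{} \<in> C" and "finite I" and "\<And>i. i \<in> I \<Longrightarrow> K i \<in> SF C"
  shows "(\<Inter>i\<in>I. K i) \<in> SF C"
proof -
  have "(\<Inter>i\<in>I. K i) = - (\<Union>i\<in>I. - K i)" by blast
  moreover have "(\<Union>i\<in>I. - K i) \<in> SF C" by (intro SF_UN SF_compl assms)
  ultimately show ?thesis by (metis SF_compl)
qed

definition containing :: "'b set set \<Rightarrow> 'b \<Rightarrow> 'b set set" where
  "containing QQ w = {Q \<in> QQ. w \<in> Q}"

lemma SF_boolean_combination:
  assumes "{} \<in> C" and "finite QQ" and "QQ \<subseteq> SF C"
    and saturated: "\<And>v w. containing QQ v = containing QQ w \<Longrightarrow> v \<in> L \<Longrightarrow> w \<in> L"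
  shows "L \<in> SF C"
proof -
  define atom where "atom P = (\<Inter>Q\<in>QQ. if Q \<in> P then Q else - Q)" for P
  have mem_atom: "w \<in> atom (containing QQ v) \<longleftrightarrow> containing QQ v = containing QQ w" for v w
  proof -
    have "w \<in> atom (containing QQ v) \<longleftrightarrow> (\<forall>Q\<in>QQ. v \<in> Q \<longleftrightarrow> w \<in> Q)"
      unfolding atom_def containing_def INT_iff by (rule ball_cong) auto
    then show ?thesis unfolding containing_def by blast
  qed
  have "L = (\<Union>P\<in>containing QQ ` L. atom P)"
  proof (intro equalityI subsetI)
    show "w \<in> (\<Union>P\<in>containing QQ ` L. atom P)" if "w \<in> L" for w
      using that by (simp add: mem_atom) blast
    fix w assume "w \<in> (\<Union>P\<in>containing QQ ` L. atom P)"
    then obtain v where "v \<in> L" "containing QQ v = containing QQ w" using mem_atom by blast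
    then show "w \<in> L" by (rule saturated[rotated])
  qed
  moreover have "finite (containing QQ ` L)"
    by (rule finite_subset[of _ "Pow QQ"]) (use assms(2) in \<open>auto simp: containing_def\<close>)
  moreover have "atom P \<in> SF C" for P
    unfolding atom_def by (intro SF_INT assms(1,2)) (use assms(3) in \<open>auto intro: SF_compl\<close>)
  ultimately show ?thesis using SF_UN[OF assms(1), of "containing QQ ` L" atom] by metis
qed

lemma SF_cover_choice:
  assumes "{} \<in> C" and cover: "is_D_cover (SF C) L KK"
    and "\<And>K. K \<in> KK \<Longrightarrow> \<exists>p\<in>A. \<forall>w\<in>K. P w p"
  obtains f where "\<And>w. w \<in> L \<Longrightarrow> f w \<in> A \<and> P w (f w)" and "\<And>p. {w. f w = p} \<in> SF C"
proof -
  have KK: "finite KK" "KK \<subseteq> SF C" "L \<subseteq> \<Union>KK"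
    using cover by (auto simp: is_D_cover_def is_cover_def)
  obtain p where p: "\<And>K. K \<in> KK \<Longrightarrow> p K \<in> A" "\<And>K w. K \<in> KK \<Longrightarrow> w \<in> K \<Longrightarrow> P w (p K)"
    using assms(3) by metis
  define pick where "pick w = (SOME K. K \<in> containing KK w)" for w
  show thesis
  proof (rule that[of "\<lambda>w. p (pick w)"])
    fix w assume "w \<in> L"
    then have "pick w \<in> containing KK w"
      using KK(3) unfolding pick_def by (intro someI_ex[of "\<lambda>K. K \<in> containing KK w"])
        (auto simp: containing_def)
    then show "p (pick w) \<in> A \<and> P w (p (pick w))" using p by (simp add: containing_def)
  next
    show "{w. p (pick w) = q} \<in> SF C" for q
      by (rule SF_boolean_combination[OF assms(1) KK(1,2)]) (simp add: pick_def)
  qed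
qed

lemma SF_lists:
  fixes C :: "'a::finite list set set"
  assumes "{} \<in> C"
  shows "lists B \<in> SF C"
proof -
  have "w \<in> conc UNIV (conc {[b]} UNIV) \<longleftrightarrow> b \<in> set w" for b and w :: "'a list"
    by (auto simp: conc_def in_set_conv_decomp)
  then have "lists B = - (\<Union>b\<in>-B. conc UNIV (conc {[b]} UNIV))"
    by (auto simp: lists_eq_set)
  moreover have "(\<Union>b\<in>-B. conc UNIV (conc {[b]} UNIV)) \<in> SF C"
    by (intro SF_UN SF_conc SF_letter SF_UNIV assms) auto
  ultimately show ?thesis by (metis SF_compl)
qed

lemma SF_Nil:
  fixes C :: "'a::finite list set set"
  assumes "{} \<in> C"
  shows "{[]} \<in> SF C"
  using SF_lists[OF assms, of "{}"] by simp

lemma SF_vimage_map: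
  fixes C :: "'a::finite list set set"
  assumes "{} \<in> C" and base: "\<And>L. L \<in> D \<Longrightarrow> map h -` L \<in> SF C" and "L \<in> SF D"
  shows "map h -` L \<in> SF C"
  using assms(3)
proof induction
  case (SF_base L)
  then show ?case by (rule base)
next
  case (SF_letter b)
  have "map h -` {[b]} = (\<Union>a\<in>{a. h a = b}. {[a]})" by (auto simp: map_eq_Cons_conv)
  moreover have "\<dots> \<in> SF C" by (intro SF_UN assms(1) SF.SF_letter) auto
  ultimately show ?case by simp
next
  case (SF_union K L)
  then show ?case by (simp add: SF.SF_union)
next
  case (SF_compl L)
  then show ?case by (simp add: SF.SF_compl vimage_Compl)
next
  case (SF_conc K L)
  have "map h -` conc K L = conc (map h -` K) (map h -` L)"
    unfolding conc_def vimage_def by (auto simp: map_eq_append_conv)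
  then show ?case using SF_conc.IH by (simp add: SF.SF_conc)
qed

section \<open>Quotients\<close>

definition quot :: "'a list \<Rightarrow> 'a list \<Rightarrow> 'a list set \<Rightarrow> 'a list set" where
  "quot x y L = {w. x @ w @ y \<in> L}"

lemma quot_Un: "quot x y (K \<union> L) = quot x y K \<union> quot x y L"
  and quot_Compl: "quot x y (- L) = - quot x y L"
  by (auto simp: quot_def)

lemma quot_letter: "quot x y {[a]} \<in> {{}, {[]}, {[a]}}"
proof -
  have "x @ w @ y = [a] \<longleftrightarrow> x = [a] \<and> w = [] \<and> y = [] \<or> x = [] \<and> w = [a] \<and> y = []
      \<or> x = [] \<and> w = [] \<and> y = [a]" for w
    by (auto simp: append_eq_Cons_conv)
  then show ?thesis by (auto simp: quot_def)
qed

lemma append_eq_append3_cases: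
  assumes "u @ v = x @ w @ y"
  obtains (left) s where "x = u @ s" "v = s @ w @ y"
    | (middle) s t where "u = x @ s" "w = s @ t" "v = t @ y"
    | (right) s where "u = x @ w @ s" "y = s @ v"
  using assms by (auto simp: append_eq_append_conv2)

lemma quot_conc:
  "quot x y (conc K L) = conc (quot x [] K) (quot [] y L)
     \<union> (\<Union>i\<in>{i. i \<le> length x \<and> take i x \<in> K}. quot (drop i x) y L)
     \<union> (\<Union>i\<in>{i. i \<le> length y \<and> drop i y \<in> L}. quot x (take i y) K)"
  (is "_ = ?mid \<union> ?left \<union> ?right")
proof (intro equalityI subsetI)
  fix w assume "w \<in> quot x y (conc K L)"
  then obtain u v where factors: "u \<in> K" "v \<in> L" "u @ v = x @ w @ y"
    by (auto simp: quot_def conc_def)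
  from factors(3) show "w \<in> ?mid \<union> ?left \<union> ?right"
  proof (cases rule: append_eq_append3_cases)
    case left
    then have "length u \<le> length x" "take (length u) x \<in> K" "w \<in> quot (drop (length u) x) y L"
      using factors by (simp_all add: quot_def)
    then show ?thesis by blast
  next
    case middle
    then show ?thesis using factors by (auto simp: quot_def conc_def)
  next
    case (right s)
    then have "length s \<le> length y" "drop (length s) y \<in> L" "w \<in> quot x (take (length s) y) K"
      using factors by (simp_all add: quot_def)
    then show ?thesis by blast
  qed
next
  fix w assume "w \<in> ?mid \<union> ?left \<union> ?right"
  then consider s t where "w = s @ t" "x @ s \<in> K" "t @ y \<in> L"
    | i where "take i x \<in> K" "drop i x @ w @ y \<in> L"
    | i where "x @ w @ take i y \<in> K" "drop i y \<in> L"
    by (auto simp: quot_def conc_def)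
  then show "w \<in> quot x y (conc K L)"
  proof cases
    case 1
    then show ?thesis using concI[of "x @ s" K "t @ y" L] by (simp add: quot_def)
  next
    case (2 i)
    then show ?thesis using concI[of "take i x" K "drop i x @ w @ y" L]
      by (simp add: quot_def flip: append_assoc)
  next
    case (3 i)
    then show ?thesis using concI[of "x @ w @ take i y" K "drop i y" L] by (simp add: quot_def)
  qed
qed

lemma SF_quot:
  fixes C :: "'a::finite list set set"
  assumes "{} \<in> C" and base: "\<And>L x y. L \<in> C \<Longrightarrow> quot x y L \<in> C" and "L \<in> SF C"
  shows "quot x y L \<in> SF C"
  using assms(3)
proof (induction arbitrary: x y)
  case (SF_base L)
  then show ?case using base SF.SF_base by blast
next
  case (SF_letter a)
  show ?case
    using quot_letter[of x y a] SF.SF_base[OF assms(1)] SF_Nil[OF assms(1)] SF.SF_letter[of a C]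
    by fastforce
next
  case (SF_union K L)
  then show ?case by (simp add: quot_Un SF.SF_union)
next
  case (SF_compl L)
  then show ?case by (simp add: quot_Compl SF.SF_compl)
next
  case (SF_conc K L)
  show ?case
    unfolding quot_conc
    by (intro SF.SF_union SF.SF_conc SF_UN assms(1) SF_conc.IH) simp_all
qed

definition quots :: "'a list set \<Rightarrow> 'a list set set" where
  "quots L = {quot x y L | x y. True}"

lemma quot_in_quots [simp]: "quot x y L \<in> quots L"
  by (auto simp: quots_def)

lemma finite_quots_SF:
  assumes base: "\<And>L. L \<in> C \<Longrightarrow> finite (quots L)" and "L \<in> SF C"
  shows "finite (quots L)"
  using assms(2)
proof induction
  case (SF_base L)
  then show ?case by (rule base)
next
  case (SF_letter a)
  have "quots {[a]} \<subseteq> {{}, {[]}, {[a]}}"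
    unfolding quots_def using quot_letter[of _ _ a] by (intro subsetI, elim CollectE exE) metis
  then show ?case by (rule finite_subset) simp
next
  case (SF_union K L)
  have "quots (K \<union> L) \<subseteq> (\<lambda>(P, Q). P \<union> Q) ` (quots K \<times> quots L)"
    by (auto simp: quots_def quot_Un)
  then show ?case by (rule finite_subset) (simp add: SF_union.IH)
next
  case (SF_compl L)
  have "quots (- L) \<subseteq> uminus ` quots L" by (auto simp: quots_def quot_Compl)
  then show ?case by (rule finite_subset) (simp add: SF_compl.IH)
next
  case (SF_conc K L)
  let ?combine = "\<lambda>(P, Q, PP, QQ). conc P Q \<union> \<Union>QQ \<union> \<Union>PP"
  have "quots (conc K L) \<subseteq> ?combine ` (quots K \<times> quots L \<times> Pow (quots K) \<times> Pow (quots L))"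
  proof
    fix M assume "M \<in> quots (conc K L)"
    then obtain x y where M: "M = quot x y (conc K L)" by (auto simp: quots_def)
    let ?PP = "(\<lambda>i. quot x (take i y) K) ` {i. i \<le> length y \<and> drop i y \<in> L}"
    let ?QQ = "(\<lambda>i. quot (drop i x) y L) ` {i. i \<le> length x \<and> take i x \<in> K}"
    have "M = ?combine (quot x [] K, quot [] y L, ?PP, ?QQ)" by (simp add: M quot_conc)
    then show "M \<in> ?combine ` (quots K \<times> quots L \<times> Pow (quots K) \<times> Pow (quots L))"
      by (rule image_eqI) auto
  qed
  then show ?case by (rule finite_subset) (simp add: SF_conc.IH)
qed

section \<open>Syntactic congruences\<close>

definition syn_le :: "'a list set \<Rightarrow> 'a list \<Rightarrow> 'a list \<Rightarrow> bool" where
  "syn_le L u v \<longleftrightarrow> (\<forall>x y. x @ u @ y \<in> L \<longrightarrow> x @ v @ y \<in> L)"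

definition syn_eq :: "'a list set \<Rightarrow> 'a list \<Rightarrow> 'a list \<Rightarrow> bool" where
  "syn_eq L u v \<longleftrightarrow> syn_le L u v \<and> syn_le L v u"

lemma syn_eq_iff: "syn_eq L u v \<longleftrightarrow> (\<forall>x y. x @ u @ y \<in> L \<longleftrightarrow> x @ v @ y \<in> L)"
  by (auto simp: syn_eq_def syn_le_def)

lemma syn_eq_append:
  assumes "syn_eq L u u'" and "syn_eq L v v'"
  shows "syn_eq L (u @ v) (u' @ v')"
proof -
  have "x @ (u @ v) @ y \<in> L \<longleftrightarrow> x @ (u' @ v') @ y \<in> L" for x y
  proof -
    have "x @ u @ (v @ y) \<in> L \<longleftrightarrow> x @ u' @ (v @ y) \<in> L"
      using assms(1) unfolding syn_eq_iff by blast
    also have "\<dots> \<longleftrightarrow> (x @ u') @ v' @ y \<in> L"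
      using assms(2) unfolding syn_eq_iff by (metis append_assoc)
    finally show ?thesis by simp
  qed
  then show ?thesis unfolding syn_eq_iff by blast
qed

text \<open>A factorization of \<open>x @ (p @ m @ q) @ y\<close> cuts either to the right of \<open>p\<close> or to the left
  of \<open>q\<close>, so that \<open>p\<close> or \<open>q\<close> can be rewritten inside one factor.\<close>

lemma syn_le_conc:
  assumes "syn_le K p p'" and "syn_le L q q'" and exchange: "p' @ m @ q = p @ m @ q'"
  shows "syn_le (conc K L) (p @ m @ q) (p' @ m @ q)"
  unfolding syn_le_def
proof (intro allI impI)
  fix x y assume "x @ (p @ m @ q) @ y \<in> conc K L"
  then obtain u v where factors: "u \<in> K" "v \<in> L" "(x @ p) @ (m @ q @ y) = u @ v"
    by (auto simp: conc_def)
  then consider s where "(x @ p) @ s = u" "m @ q @ y = s @ v"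
    | s where "x @ p = u @ s" "s @ m @ q @ y = v"
    unfolding append_eq_append_conv2[of "x @ p"] by blast
  then show "x @ (p' @ m @ q) @ y \<in> conc K L"
  proof cases
    case (1 s)
    then have "x @ p' @ s \<in> K" using factors(1) assms(1) unfolding syn_le_def by auto
    moreover have "x @ (p' @ m @ q) @ y = (x @ p' @ s) @ v" using 1(2) by simp
    ultimately show ?thesis using factors(2) by (metis concI)
  next
    case (2 s)
    then have "(s @ m) @ q' @ y \<in> L"
      using factors(2) assms(2) unfolding syn_le_def by (metis append_assoc)
    moreover have "x @ (p' @ m @ q) @ y = u @ (s @ m) @ q' @ y"
      using 2 exchange by (metis append_assoc)
    ultimately show ?thesis using factors(1) by (metis concI)
  qed
qed

definition syn_class :: "'a list set set \<Rightarrow> 'a list \<Rightarrow> 'a list set" where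
  "syn_class KK w = {v. \<forall>K\<in>KK. syn_eq K v w}"

lemma syn_class_self: "w \<in> syn_class KK w"
  by (simp add: syn_class_def syn_eq_iff)

lemma syn_class_eqI: "v \<in> syn_class KK w \<Longrightarrow> syn_class KK v = syn_class KK w"
  by (auto simp: syn_class_def syn_eq_iff)

lemma syn_class_subset: "w \<in> K \<Longrightarrow> K \<in> KK \<Longrightarrow> syn_class KK w \<subseteq> K"
  unfolding syn_class_def syn_eq_iff by (auto, metis append_Nil append_Nil2)

lemma conc_syn_class_subset: "conc (syn_class KK u) (syn_class KK v) \<subseteq> syn_class KK (u @ v)"
  by (auto simp: conc_def syn_class_def intro: syn_eq_append)

locale finite_quotient_closed =
  fixes C :: "'a::finite list set set"
  assumes finite_family: "finite C" and empty_mem: "{} \<in> C"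
    and quot_mem: "L \<in> C \<Longrightarrow> quot x y L \<in> C"
begin

lemma finite_quots: "L \<in> SF C \<Longrightarrow> finite (quots L)"
proof (rule finite_quots_SF)
  fix L assume "L \<in> C"
  then have "quots L \<subseteq> C" using quot_mem by (auto simp: quots_def)
  then show "finite (quots L)" using finite_family by (rule finite_subset)
qed

lemma syn_class_cong:
  assumes "containing (\<Union>(quots ` KK)) v = containing (\<Union>(quots ` KK)) w"
  shows "syn_class KK v = syn_class KK w"
proof (rule syn_class_eqI)
  have "v \<in> quot x y K \<longleftrightarrow> w \<in> quot x y K" if "K \<in> KK" for K x y
  proof -
    have "quot x y K \<in> \<Union>(quots ` KK)" using that quot_in_quots by blast
    then show ?thesis using assms unfolding containing_def by blast
  qed
  then show "v \<in> syn_class KK w" by (simp add: syn_class_def syn_eq_iff quot_def)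
qed

context
  fixes KK :: "'a list set set"
  assumes KK: "finite KK" "KK \<subseteq> SF C"
begin

lemma finite_Union_quots: "finite (\<Union>(quots ` KK))"
  using KK finite_quots by blast

lemma SF_syn_class: "syn_class KK w \<in> SF C"
proof (rule SF_boolean_combination[OF empty_mem finite_Union_quots])
  show "\<Union>(quots ` KK) \<subseteq> SF C"
    using KK(2) SF_quot[OF empty_mem quot_mem] by (auto simp: quots_def)
  show "v \<in> syn_class KK w" if "containing (\<Union>(quots ` KK)) u = containing (\<Union>(quots ` KK)) v"
    and "u \<in> syn_class KK w" for u v
    using that syn_class_cong syn_class_eqI syn_class_self by metis
qed

lemma finite_range_syn_class: "finite (range (syn_class KK))"
proof -
  let ?QQ = "\<Union>(quots ` KK)"
  have "\<exists>K. \<forall>w. containing ?QQ w = P \<longrightarrow> syn_class KK w = K" for P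
    using syn_class_cong by metis
  then obtain h where "syn_class KK w = h (containing ?QQ w)" for w by metis
  then have "range (syn_class KK) \<subseteq> h ` Pow ?QQ" by (auto simp: containing_def)
  then show ?thesis using finite_Union_quots by (meson finite_Pow_iff finite_imageI finite_subset)
qed

end

end

section \<open>Eventually constant powers\<close>

definition word_power :: "'a list \<Rightarrow> nat \<Rightarrow> 'a list" where
  "word_power w n = concat (replicate n w)"

lemma word_power_0 [simp]: "word_power w 0 = []"
  and word_power_Suc: "word_power w (Suc n) = w @ word_power w n"
  by (simp_all add: word_power_def)

lemma word_power_add: "word_power w (m + n) = word_power w m @ word_power w n"
  by (simp add: word_power_def replicate_add)

definition stable_at :: "'a list set \<Rightarrow> 'a list \<Rightarrow> nat \<Rightarrow> bool" where
  "stable_at L w k \<longleftrightarrow> syn_eq L (word_power w k) (word_power w (Suc k))"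

lemma stable_at_mono:
  assumes "stable_at L w k" and "k \<le> n"
  shows "stable_at L w n"
proof -
  from assms(2) obtain d where n: "n = d + k" by (metis le_iff_add add.commute)
  have "syn_eq L (word_power w d) (word_power w d)" by (simp add: syn_eq_iff)
  then show ?thesis
    using assms(1) unfolding stable_at_def n add_Suc_right[symmetric] word_power_add
    by (rule syn_eq_append)
qed

lemma stable_at_letter: "stable_at {[a]} w 2"
proof (cases "w = []")
  case True
  then show ?thesis by (simp add: stable_at_def syn_eq_iff word_power_def)
next
  case False
  then have "length w \<ge> 1" by (cases w) auto
  then have "length (x @ word_power w n @ y) \<ge> n" for x y n
    by (induction n) (auto simp: word_power_Suc)
  then have "x @ word_power w n @ y \<noteq> [a]" if "n \<ge> 2" for x y n
    using that by (metis One_nat_def Suc_1 length_Cons list.size(3) not_less_eq_eq order_trans)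
  then show ?thesis by (simp add: stable_at_def syn_eq_iff)
qed

lemma stable_at_conc:
  assumes "stable_at K w a" and "stable_at L w b"
  shows "stable_at (conc K L) w (Suc (a + b))"
proof -
  let ?p = "word_power w"
  have stable_K: "syn_le K (?p a) (?p (Suc a))" "syn_le K (?p (Suc a)) (?p a)"
    and stable_L: "syn_le L (?p b) (?p (Suc b))" "syn_le L (?p (Suc b)) (?p b)"
    using assms by (simp_all add: stable_at_def syn_eq_def)
  have "syn_le (conc K L) (?p a @ ?p 1 @ ?p b) (?p (Suc a) @ ?p 1 @ ?p b)"
    by (rule syn_le_conc[OF stable_K(1) stable_L(1)]) (simp flip: word_power_add)
  moreover have "syn_le (conc K L) (?p (Suc a) @ ?p 0 @ ?p (Suc b)) (?p a @ ?p 0 @ ?p (Suc b))"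
    by (rule syn_le_conc[OF stable_K(2) stable_L(2)]) (simp flip: word_power_add)
  ultimately show ?thesis
    unfolding stable_at_def syn_eq_def by (simp flip: word_power_add)
qed

lemma stable_at_SF:
  assumes "\<And>L. L \<in> C \<Longrightarrow> \<exists>k. stable_at L w k" and "L \<in> SF C"
  shows "\<exists>k. stable_at L w k"
  using assms(2)
proof induction
  case (SF_base L)
  then show ?case by (rule assms(1))
next
  case (SF_letter a)
  then show ?case by (blast intro: stable_at_letter)
next
  case (SF_union K L)
  then obtain a b where "stable_at K w a" "stable_at L w b" by blast
  then have "stable_at K w (a + b)" "stable_at L w (a + b)" by (auto intro: stable_at_mono)
  then have "stable_at (K \<union> L) w (a + b)" by (auto simp: stable_at_def syn_eq_iff)
  then show ?case ..
next
  case (SF_compl L)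
  then show ?case by (simp add: stable_at_def syn_eq_iff)
next
  case (SF_conc K L)
  then show ?case using stable_at_conc by blast
qed

lemma uniformly_stable_at:
  assumes "finite KK" and "\<And>K. K \<in> KK \<Longrightarrow> \<exists>k. stable_at K w k"
  shows "\<exists>k. \<forall>K\<in>KK. stable_at K w k"
proof -
  from assms(2) obtain k where stable_k: "\<And>K. K \<in> KK \<Longrightarrow> stable_at K w (k K)" by metis
  have "stable_at K w (sum k KK)" if "K \<in> KK" for K
    using that assms(1) by (blast intro: stable_at_mono[OF stable_k] member_le_sum)
  then show ?thesis by blast
qed

lemma syn_class_word_power_Suc:
  assumes "\<forall>K\<in>KK. stable_at K w n"
  shows "syn_class KK (word_power w (Suc n)) = syn_class KK (word_power w n)"
  using assms by (intro syn_class_eqI) (simp add: syn_class_def stable_at_def syn_eq_def)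

section \<open>The canonical order of a rating algebra\<close>

lemma rle_trans: "rle r s \<Longrightarrow> rle s t \<Longrightarrow> rle r (t::'r::semigroup_add)"
  unfolding rle_def by (metis add.assoc)

lemma rle_add: "rle r t \<Longrightarrow> rle s t \<Longrightarrow> rle (r + s) (t::'r::semigroup_add)"
  unfolding rle_def by (metis add.assoc)

lemma rle_mult:
  assumes "rle p q" and "rle r s"
  shows "rle (p * r) (q * (s::'r::semiring))"
proof (rule rle_trans)
  show "rle (p * r) (q * r)" using assms(1) unfolding rle_def by (metis distrib_right)
  show "rle (q * r) (q * s)" using assms(2) unfolding rle_def by (metis distrib_left)
qed

lemma rle_power:
  fixes r s :: "'r::{semiring_0,monoid_mult}"
  assumes "\<And>t::'r. t + t = t" and "rle r s"
  shows "rle (r ^ n) (s ^ n)"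
proof (induction n)
  case 0
  then show ?case by (simp add: rle_def assms(1))
next
  case (Suc n)
  then show ?case using rle_mult[OF assms(2)] by simp
qed

lemma rating_map_mono:
  assumes "rating_map \<rho>" and "K \<subseteq> L"
  shows "rle (\<rho> K) (\<rho> L)"
  using assms by (metis rating_map_def rle_def Un_absorb1)

lemma nice_rating_le:
  assumes "rating_map \<rho>" and "nice \<rho>" and words: "\<And>w. w \<in> K \<Longrightarrow> rle (\<rho> {w}) r"
  shows "rle (\<rho> K) r"
proof -
  have \<rho>_Un: "\<rho> (K \<union> L) = \<rho> K + \<rho> L" and \<rho>_empty: "\<rho> {} = 0" for K L
    using assms(1) by (auto simp: rating_map_def)
  obtain F where F: "finite F" "F \<subseteq> K" "\<rho> K = \<rho> F" using assms(2) unfolding nice_def by blast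
  from F(1,2) have "rle (\<rho> F) r"
  proof induction
    case empty
    then show ?case by (simp add: \<rho>_empty rle_def)
  next
    case (insert w F)
    then show ?case using rle_add[OF words] \<rho>_Un[of "{w}" F] by simp
  qed
  then show ?thesis by (simp add: F(3))
qed

section \<open>Optimal imprints\<close>

lemma is_D_cover_Int:
  assumes "lattice D" and "is_D_cover D L KK" and "is_D_cover D L MM"
  shows "is_D_cover D L ((\<lambda>(K, M). K \<inter> M) ` (KK \<times> MM))"
  unfolding is_D_cover_def is_cover_def
proof (intro conjI)
  show "finite ((\<lambda>(K, M). K \<inter> M) ` (KK \<times> MM))"
    using assms(2,3) by (simp add: is_D_cover_def is_cover_def)
  show "(\<lambda>(K, M). K \<inter> M) ` (KK \<times> MM) \<subseteq> D"
    using assms by (auto simp: is_D_cover_def lattice_def)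
  have "L \<subseteq> \<Union>KK \<inter> \<Union>MM" using assms(2,3) by (simp add: is_D_cover_def is_cover_def)
  then show "L \<subseteq> \<Union>((\<lambda>(K, M). K \<inter> M) ` (KK \<times> MM))" by blast
qed

lemma imprint_Int_subset:
  assumes "rating_map (\<rho>::'a list set \<Rightarrow> 'r::{comm_monoid_add,finite})"
  shows "imprint \<rho> ((\<lambda>(K, M). K \<inter> M) ` (KK \<times> MM)) \<subseteq> imprint \<rho> KK \<inter> imprint \<rho> MM"
proof
  fix r assume "r \<in> imprint \<rho> ((\<lambda>(K, M). K \<inter> M) ` (KK \<times> MM))"
  then obtain K M where "K \<in> KK" "M \<in> MM" "rle r (\<rho> (K \<inter> M))" by (auto simp: imprint_def)
  moreover have "rle (\<rho> (K \<inter> M)) (\<rho> K)" "rle (\<rho> (K \<inter> M)) (\<rho> M)"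
    by (auto intro: rating_map_mono[OF assms])
  ultimately show "r \<in> imprint \<rho> KK \<inter> imprint \<rho> MM"
    unfolding imprint_def by (blast intro: rle_trans)
qed

lemma ex_optimal_cover:
  fixes \<rho> :: "'a list set \<Rightarrow> 'r::{comm_monoid_add,finite}"
  assumes "lattice D" and "rating_map \<rho>"
  shows "\<exists>KK. is_D_cover D L KK \<and> (\<forall>MM. is_D_cover D L MM \<longrightarrow> imprint \<rho> KK \<subseteq> imprint \<rho> MM)"
proof -
  have "is_D_cover D L {UNIV}"
    using assms(1) by (simp add: is_D_cover_def is_cover_def lattice_def)
  then obtain KK where KK: "is_D_cover D L KK"
    and least: "\<And>MM. is_D_cover D L MM \<Longrightarrow> card (imprint \<rho> KK) \<le> card (imprint \<rho> MM)"
    using ex_has_least_nat[of "is_D_cover D L" _ "\<lambda>KK. card (imprint \<rho> KK)"] by blast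
  have "imprint \<rho> KK \<subseteq> imprint \<rho> MM" if "is_D_cover D L MM" for MM
  proof -
    let ?II = "(\<lambda>(K, M). K \<inter> M) ` (KK \<times> MM)"
    have "imprint \<rho> ?II = imprint \<rho> KK"
      using imprint_Int_subset[OF assms(2)] least[OF is_D_cover_Int[OF assms(1) KK that]]
      by (intro card_seteq) auto
    then show ?thesis using imprint_Int_subset[OF assms(2), of KK MM] by simp
  qed
  then show ?thesis using KK by blast
qed

lemma opt_imprint_iff:
  fixes \<rho> :: "'a list set \<Rightarrow> 'r::{comm_monoid_add,finite}"
  assumes "lattice D" and "rating_map \<rho>"
  shows "r \<in> opt_imprint D L \<rho> \<longleftrightarrow> (\<forall>KK. is_D_cover D L KK \<longrightarrow> r \<in> imprint \<rho> KK)"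
proof -
  let ?optimal = "\<lambda>KK. is_D_cover D L KK \<and>
    (\<forall>MM. is_D_cover D L MM \<longrightarrow> imprint \<rho> KK \<subseteq> imprint \<rho> MM)"
  have "?optimal (Eps ?optimal)" using ex_optimal_cover[OF assms] by (rule someI_ex)
  then show ?thesis unfolding opt_imprint_def by blast
qed

section \<open>Saturation of the optimal imprints\<close>

locale rated_family = finite_quotient_closed C
  for C :: "'a::finite list set set" +
  fixes \<rho> :: "'a list set \<Rightarrow> 'r::{semiring_0,monoid_mult,finite}"
  assumes multiplicative: "multiplicative_rating_map \<rho>"
begin

lemma rating: "rating_map \<rho>" and \<rho>_Nil: "\<rho> {[]} = 1" and \<rho>_conc: "\<rho> (conc K L) = \<rho> K * \<rho> L"
  and add_idem: "r + r = (r::'r)"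
  using multiplicative by (auto simp: multiplicative_rating_map_def rating_map_def)

lemma opt_imprint_iff_syn_class:
  "r \<in> opt_imprint (SF C) L \<rho> \<longleftrightarrow>
     (\<forall>KK. finite KK \<longrightarrow> KK \<subseteq> SF C \<longrightarrow> (\<exists>w\<in>L. rle r (\<rho> (syn_class KK w))))"
  (is "_ \<longleftrightarrow> ?classes")
  unfolding opt_imprint_iff[OF lattice_SF[OF empty_mem] rating]
proof (intro iffI allI impI)
  fix KK assume covers: "\<forall>KK. is_D_cover (SF C) L KK \<longrightarrow> r \<in> imprint \<rho> KK"
    and KK: "finite KK" "KK \<subseteq> SF C"
  have "finite (syn_class KK ` L)"
    using finite_range_syn_class[OF KK] by (rule finite_subset[rotated]) blast
  then have "is_D_cover (SF C) L (syn_class KK ` L)"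
    using SF_syn_class[OF KK] syn_class_self[of _ KK] by (auto simp: is_D_cover_def is_cover_def)
  then show "\<exists>w\<in>L. rle r (\<rho> (syn_class KK w))" using covers by (fastforce simp: imprint_def)
next
  fix KK assume ?classes and "is_D_cover (SF C) L KK"
  moreover from this have KK: "finite KK" "KK \<subseteq> SF C" "L \<subseteq> \<Union>KK"
    by (auto simp: is_D_cover_def is_cover_def)
  ultimately obtain w where w: "w \<in> L" "rle r (\<rho> (syn_class KK w))" by blast
  then obtain K where K: "K \<in> KK" "w \<in> K" using KK(3) by blast
  then have "rle r (\<rho> K)"
    using rle_trans[OF w(2)] rating_map_mono[OF rating syn_class_subset] by blast
  then show "r \<in> imprint \<rho> KK" using K(1) unfolding imprint_def by blast
qed

lemma opt_imprint_syn_class: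
  assumes "r \<in> opt_imprint (SF C) L \<rho>" and "finite KK" and "KK \<subseteq> SF C"
  obtains w where "w \<in> L" and "rle r (\<rho> (syn_class KK w))"
  using assms by (auto simp: opt_imprint_iff_syn_class)

lemma opt_imprint_mono: "K \<subseteq> L \<Longrightarrow> opt_imprint (SF C) K \<rho> \<subseteq> opt_imprint (SF C) L \<rho>"
  unfolding subset_iff opt_imprint_iff_syn_class by blast

lemma opt_imprint_downward: "r \<in> opt_imprint (SF C) L \<rho> \<Longrightarrow> rle q r \<Longrightarrow> q \<in> opt_imprint (SF C) L \<rho>"
  unfolding opt_imprint_iff_syn_class using rle_trans by blast

lemma opt_imprint_word: "w \<in> L \<Longrightarrow> \<rho> {w} \<in> opt_imprint (SF C) L \<rho>"
  unfolding opt_imprint_iff_syn_class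
  using rating_map_mono[OF rating, of "{w}"] syn_class_self[of w] by blast

lemma rating_syn_class_mult:
  "rle (\<rho> (syn_class KK u) * \<rho> (syn_class KK v)) (\<rho> (syn_class KK (u @ v)))"
  using rating_map_mono[OF rating conc_syn_class_subset] by (simp add: \<rho>_conc)

lemma rating_syn_class_power:
  "rle (\<rho> (syn_class KK w) ^ n) (\<rho> (syn_class KK (word_power w n)))"
proof (induction n)
  case 0
  show ?case
    using rating_map_mono[OF rating, of "{[]}" "syn_class KK []"]
    by (simp add: \<rho>_Nil syn_class_self)
next
  case (Suc n)
  have "rle (\<rho> (syn_class KK w)) (\<rho> (syn_class KK w))" by (simp add: rle_def add_idem)
  from rle_trans[OF rle_mult[OF this Suc] rating_syn_class_mult]
  show ?case by (simp add: word_power_Suc)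
qed

lemma opt_imprint_mult:
  assumes "q \<in> opt_imprint (SF C) K \<rho>" and "r \<in> opt_imprint (SF C) L \<rho>"
  shows "q * r \<in> opt_imprint (SF C) (conc K L) \<rho>"
  unfolding opt_imprint_iff_syn_class
proof (intro allI impI)
  fix KK assume "finite KK" "KK \<subseteq> SF C"
  then obtain u v where "u \<in> K" "rle q (\<rho> (syn_class KK u))"
    and "v \<in> L" "rle r (\<rho> (syn_class KK v))"
    using assms opt_imprint_syn_class by metis
  then have "u @ v \<in> conc K L" "rle (q * r) (\<rho> (syn_class KK (u @ v)))"
    using rle_trans[OF rle_mult rating_syn_class_mult] by (auto simp: conc_def)
  then show "\<exists>w\<in>conc K L. rle (q * r) (\<rho> (syn_class KK w))" by blast
qed

lemma opt_imprint_power_sum: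
  assumes "conc L L \<subseteq> L" and stable: "\<And>w K. w \<in> L \<Longrightarrow> K \<in> C \<Longrightarrow> \<exists>k. stable_at K w k"
    and \<omega>: "\<omega> > 0" "\<And>r::'r. r ^ \<omega> * r ^ \<omega> = r ^ \<omega>"
    and r: "r \<in> opt_imprint (SF C) L \<rho>"
  shows "r ^ \<omega> + r ^ (\<omega> + 1) \<in> opt_imprint (SF C) L \<rho>"
  unfolding opt_imprint_iff_syn_class
proof (intro allI impI)
  fix KK assume KK: "finite KK" "KK \<subseteq> SF C"
  then obtain w where w: "w \<in> L" "rle r (\<rho> (syn_class KK w))"
    using r opt_imprint_syn_class by metis
  have "\<exists>k. stable_at K w k" if "K \<in> KK" for K
    using stable_at_SF[OF stable[OF w(1)]] that KK(2) by blast
  then obtain k where k: "\<forall>K\<in>KK. stable_at K w k" using uniformly_stable_at[OF KK(1)] by blast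
  define n where "n = \<omega> * Suc k"
  have "k \<le> n" "n > 0" using \<omega>(1) by (cases \<omega>; simp add: n_def)+
  then have "\<forall>K\<in>KK. stable_at K w n" using k stable_at_mono by blast
  note class_Suc = syn_class_word_power_Suc[OF this]
  have "(r ^ \<omega>) ^ Suc k = r ^ \<omega>" by (induction k) (simp_all add: \<omega>(2))
  then have power_n: "r ^ n = r ^ \<omega>" by (simp only: n_def power_mult)
  have power_le: "rle (r ^ m) (\<rho> (syn_class KK (word_power w m)))" for m
    using rle_trans[OF rle_power[OF add_idem w(2)] rating_syn_class_power] .
  have "rle (r ^ n + r ^ Suc n) (\<rho> (syn_class KK (word_power w n)))"
    using power_le[of n] power_le[of "Suc n"] unfolding class_Suc by (rule rle_add)
  moreover have "word_power w (Suc m) \<in> L" for m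
    using w(1) assms(1) by (induction m) (auto simp: word_power_Suc conc_def)
  then have "word_power w n \<in> L" using \<open>n > 0\<close> by (metis Suc_pred)
  ultimately show "\<exists>w\<in>L. rle (r ^ \<omega> + r ^ (\<omega> + 1)) (\<rho> (syn_class KK w))"
    by (auto simp: power_n)
qed

end

lemma finite_quotient_closed_prevariety:
  assumes "prevariety C" and "finite C"
  shows "finite_quotient_closed C"
proof
  show "finite C" by (rule assms(2))
  show "{} \<in> C" using assms(1) by (simp add: prevariety_def lattice_def)
  have "quot x y L = {w. w @ y \<in> {v. x @ v \<in> L}}" for x y and L :: "'a list set"
    by (simp add: quot_def)
  then show "quot x y L \<in> C" if "L \<in> C" for L x y
    using assms(1) that unfolding prevariety_def by metis
qed

lemma SF_saturated_opt_imprint: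
  fixes C :: "'a::finite list set set"
    and \<eta> :: "'a list \<Rightarrow> 'n::{monoid_mult,finite}"
    and \<rho> :: "'a list set \<Rightarrow> 'r::{semiring_0,monoid_mult,finite}"
  assumes "prevariety C" and "finite C"
    and \<eta>: "canonical_C_morphism C \<eta>"
    and \<rho>: "multiplicative_rating_map \<rho>"
    and \<omega>: "\<omega> > 0" "\<forall>r::'r. r ^ \<omega> * r ^ \<omega> = r ^ \<omega>"
  shows "SF_saturated \<eta> \<rho> \<omega> {(t, r). r \<in> opt_imprint (SF C) (\<eta> -` {t}) \<rho>}"
proof -
  interpret finite_quotient_closed C
    using assms(1,2) by (rule finite_quotient_closed_prevariety)
  interpret rated_family C \<rho> by unfold_locales (rule \<rho>)
  have \<eta>_append: "\<eta> (u @ v) = \<eta> u * \<eta> v" for u v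
    using \<eta> by (simp add: canonical_C_morphism_def C_morphism_def monoid_morphism_def)
  have conc_fibres: "conc (\<eta> -` {s}) (\<eta> -` {t}) \<subseteq> \<eta> -` {s * t}" for s t
    by (auto simp: conc_def \<eta>_append)
  have stable: "\<exists>k. stable_at K w k" if idem: "\<eta> w * \<eta> w = \<eta> w" and K: "K \<in> C" for w K
  proof -
    obtain F where "K = \<eta> -` F" using \<eta> K by (auto simp: canonical_C_morphism_def)
    moreover have "\<eta> w * (\<eta> w * t) = \<eta> w * t" for t using idem by (metis mult.assoc)
    ultimately have "stable_at K w 1"
      by (simp add: stable_at_def syn_eq_iff word_power_Suc \<eta>_append)
    then show ?thesis ..
  qed
  show ?thesis
    unfolding SF_saturated_def mem_Collect_eq prod.case
  proof (intro conjI allI impI; (elim conjE)?)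
    show "\<rho> {w} \<in> opt_imprint (SF C) (\<eta> -` {\<eta> w}) \<rho>" for w
      by (simp add: opt_imprint_word)
    show "q \<in> opt_imprint (SF C) (\<eta> -` {t}) \<rho>"
      if "r \<in> opt_imprint (SF C) (\<eta> -` {t}) \<rho>" "rle q r" for t r q
      using that by (rule opt_imprint_downward)
    show "q * r \<in> opt_imprint (SF C) (\<eta> -` {s * t}) \<rho>"
      if "q \<in> opt_imprint (SF C) (\<eta> -` {s}) \<rho>" "r \<in> opt_imprint (SF C) (\<eta> -` {t}) \<rho>" for s q t r
      using opt_imprint_mult[OF that] opt_imprint_mono[OF conc_fibres] by blast
    show "r ^ \<omega> + r ^ (\<omega> + 1) \<in> opt_imprint (SF C) (\<eta> -` {e}) \<rho>"
      if "r \<in> opt_imprint (SF C) (\<eta> -` {e}) \<rho>" "e * e = e" for e r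
      using conc_fibres[of e e] stable that \<omega> by (intro opt_imprint_power_sum) auto
  qed
qed

section \<open>Words delimited by a letter\<close>

definition delimit :: "'a \<Rightarrow> 'a list list \<Rightarrow> 'a list" where
  "delimit c us = concat (map (\<lambda>u. u @ [c]) us)"

lemma delimit_Nil [simp]: "delimit c [] = []"
  and delimit_Cons [simp]: "delimit c (u # us) = u @ c # delimit c us"
  and delimit_append [simp]: "delimit c (us @ vs) = delimit c us @ delimit c vs"
  by (simp_all add: delimit_def)

lemma delimit_image_conc: "delimit c ` conc U V = conc (delimit c ` U) (delimit c ` V)"
proof (intro equalityI subsetI)
  fix w assume "w \<in> delimit c ` conc U V"
  then obtain us vs where "us \<in> U" "vs \<in> V" "w = delimit c us @ delimit c vs"
    by (auto simp: conc_def)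
  then show "w \<in> conc (delimit c ` U) (delimit c ` V)" unfolding conc_def by blast
next
  fix w assume "w \<in> conc (delimit c ` U) (delimit c ` V)"
  then obtain us vs where "us \<in> U" "vs \<in> V" "w = delimit c (us @ vs)" by (auto simp: conc_def)
  then show "w \<in> delimit c ` conc U V" unfolding conc_def by blast
qed

lemma append_Cons_eq_append_Cons_iff:
  assumes "c \<notin> set u" and "c \<notin> set v"
  shows "u @ c # x = v @ c # y \<longleftrightarrow> u = v \<and> x = y"
  using assms by (auto simp: append_eq_append_conv2 append_eq_Cons_conv Cons_eq_append_conv)

lemma inj_on_delimit:
  assumes "c \<notin> B"
  shows "inj_on (delimit c) (lists (lists B))"
proof
  fix us vs assume "us \<in> lists (lists B)" "vs \<in> lists (lists B)" "delimit c us = delimit c vs"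
  then show "us = vs"
  proof (induction us arbitrary: vs)
    case Nil
    then show ?case by (cases vs) auto
  next
    case (Cons u us)
    then obtain v vs' where vs: "vs = v # vs'" by (cases vs) auto
    have "c \<notin> set u" "c \<notin> set v" using Cons vs assms by auto
    moreover have "u @ c # delimit c us = v @ c # delimit c vs'" using Cons.prems vs by simp
    ultimately have heads_tails: "u = v" "delimit c us = delimit c vs'"
      by (simp_all add: append_Cons_eq_append_Cons_iff)
    have "us = vs'" by (rule Cons.IH) (use Cons.prems vs heads_tails(2) in simp_all)
    then show ?case by (simp add: vs heads_tails(1))
  qed
qed

lemma lists_insert_eq_conc_delimit:
  "lists (insert c B) = conc (delimit c ` lists (lists B)) (lists B)"
proof (intro equalityI subsetI)
  fix w assume "w \<in> lists (insert c B)"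
  then have "\<exists>us\<in>lists (lists B). \<exists>v\<in>lists B. w = delimit c us @ v"
  proof induction
    case Nil
    show ?case by (intro bexI[of _ "[]"]) auto
  next
    case (Cons a w)
    then obtain us v where w: "us \<in> lists (lists B)" "v \<in> lists B" "w = delimit c us @ v" by blast
    consider "a = c" | "a \<in> B" "us = []" | u us' where "a \<in> B" "us = u # us'"
      using Cons.hyps(1) by (cases us) auto
    then show ?case
    proof cases
      case 1
      then show ?thesis using w by (intro bexI[of _ "[] # us"] bexI[of _ v]) auto
    next
      case 2
      then show ?thesis using w by (intro bexI[of _ "[]"] bexI[of _ "a # v"]) auto
    next
      case 3
      then show ?thesis using w by (intro bexI[of _ "(a # u) # us'"] bexI[of _ v]) auto
    qed
  qed
  then show "w \<in> conc (delimit c ` lists (lists B)) (lists B)" unfolding conc_def by blast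
next
  have "delimit c us \<in> lists (insert c B)" if "us \<in> lists (lists B)" for us
    using that by induction auto
  moreover have "lists B \<subseteq> lists (insert c B)" by (rule lists_mono) blast
  moreover fix w assume "w \<in> conc (delimit c ` lists (lists B)) (lists B)"
  ultimately show "w \<in> lists (insert c B)" unfolding conc_def by fastforce
qed

lemma delimit_image_lists:
  "delimit c ` lists (lists B) = {[]} \<union> conc (lists (insert c B)) {[c]}"
proof (intro equalityI subsetI)
  fix w assume "w \<in> delimit c ` lists (lists B)"
  then obtain us where us: "us \<in> lists (lists B)" "w = delimit c us" by blast
  show "w \<in> {[]} \<union> conc (lists (insert c B)) {[c]}"
  proof (cases us rule: rev_cases)
    case Nil
    then show ?thesis using us by simp
  next
    case (snoc vs u)
    then have "w = (delimit c vs @ u) @ [c]" "vs \<in> lists (lists B)" "u \<in> lists B" using us by auto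
    then show ?thesis unfolding lists_insert_eq_conc_delimit conc_def by blast
  qed
next
  fix w assume "w \<in> {[]} \<union> conc (lists (insert c B)) {[c]}"
  then consider "w = delimit c []"
    | us u where "us \<in> lists (lists B)" "u \<in> lists B" "w = delimit c (us @ [u])"
    unfolding lists_insert_eq_conc_delimit conc_def by fastforce
  then show "w \<in> delimit c ` lists (lists B)"
    by cases (blast, fastforce)
qed

lemma SF_delimit_image_lists:
  fixes C :: "'a::finite list set set"
  assumes "{} \<in> C"
  shows "delimit c ` lists (lists B) \<in> SF C"
  unfolding delimit_image_lists by (intro SF_union SF_conc SF_letter SF_lists SF_Nil assms)

abbreviation delimit_vimage ::
  "'a \<Rightarrow> 'a set \<Rightarrow> ('a list \<Rightarrow> 'b) \<Rightarrow> 'b list set \<Rightarrow> 'a list set" where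
  "delimit_vimage c B g L \<equiv> delimit c ` {us \<in> lists (lists B). map g us \<in> L}"

lemma SF_delimit_vimage:
  fixes C :: "'a::finite list set set" and D :: "'b list set set"
  assumes "{} \<in> C" and "c \<notin> B"
    and letter: "\<And>b. {u \<in> lists B. g u = b} \<in> SF C"
    and base: "\<And>L. L \<in> D \<Longrightarrow> delimit_vimage c B g L \<in> SF C"
    and "L \<in> SF D"
  shows "delimit_vimage c B g L \<in> SF C"
  using assms(5)
proof induction
  case (SF_base L)
  then show ?case by (rule base)
next
  case (SF_letter b)
  have "{us \<in> lists (lists B). map g us \<in> {[b]}} = (\<lambda>u. [u]) ` {u \<in> lists B. g u = b}"
    by (auto simp: map_eq_Cons_conv)
  then have "delimit_vimage c B g {[b]} =
      conc {u \<in> lists B. g u = b} {[c]}"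
    by (auto simp: conc_def image_image)
  then show ?case by (simp only: SF.SF_conc letter SF.SF_letter)
next
  case (SF_union K L)
  have "delimit_vimage c B g (K \<union> L) =
      delimit_vimage c B g K \<union> delimit_vimage c B g L" by blast
  then show ?case by (simp only: SF.SF_union SF_union.IH)
next
  case (SF_compl L)
  have "{us \<in> lists (lists B). map g us \<in> - L} =
      lists (lists B) - {us \<in> lists (lists B). map g us \<in> L}" by blast
  then have "delimit_vimage c B g (- L) =
      delimit c ` lists (lists B) \<inter> - delimit_vimage c B g L"
    using inj_on_image_set_diff[OF inj_on_delimit[OF assms(2)]] by (simp add: Diff_eq)
  then show ?case
    by (simp only: SF_inter SF.SF_compl SF_compl.IH SF_delimit_image_lists[OF assms(1)])
next
  case (SF_conc K L)
  have "{us \<in> lists (lists B). map g us \<in> conc K L} =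
      conc {us \<in> lists (lists B). map g us \<in> K} {us \<in> lists (lists B). map g us \<in> L}"
    unfolding conc_def by (auto simp: map_eq_append_conv simp del: in_lists_conv_set) blast+
  then show ?case by (simp only: delimit_image_conc SF.SF_conc SF_conc.IH)
qed

section \<open>Monoid elements permuting a set\<close>

abbreviation right_translate :: "'m::times set \<Rightarrow> 'm \<Rightarrow> 'm set"  (infixl "#>" 70) where
  "X #> g \<equiv> (\<lambda>x. x * g) ` X"

definition permutes_on :: "'m::monoid_mult set \<Rightarrow> 'm \<Rightarrow> bool" where
  "permutes_on X g \<longleftrightarrow> X #> g = X"

lemma permutes_on_one: "permutes_on X 1"
  by (simp add: permutes_on_def)

lemma permutes_on_mult:
  assumes "permutes_on X g" and "permutes_on X h"
  shows "permutes_on X (g * h)"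
proof -
  have "X #> (g * h) = X #> g #> h"
    by (simp add: image_image mult.assoc)
  then show ?thesis using assms by (simp add: permutes_on_def)
qed

lemma permutes_on_power: "permutes_on X g \<Longrightarrow> permutes_on X (g ^ n)"
  by (induction n) (simp_all add: permutes_on_one permutes_on_mult)

lemma permutes_on_prod_list:
  assumes "\<And>b. b \<in> B \<Longrightarrow> permutes_on X b" and "w \<in> lists B"
  shows "permutes_on X (prod_list w)"
  using assms(2) by induction (simp_all add: permutes_on_one permutes_on_mult assms(1))

lemma permutes_on_idempotent:
  assumes "permutes_on X g" and "g * g = g" and "x \<in> X"
  shows "x * g = x"
proof -
  obtain y where "x = y * g" using assms(1,3) unfolding permutes_on_def by blast
  then show ?thesis by (simp add: mult.assoc assms(2))
qed

lemma permutes_on_power_eq_id: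
  fixes g :: "'m::{monoid_mult,finite}"
  assumes "permutes_on X g"
  obtains n where "n > 0" and "\<And>x. x \<in> X \<Longrightarrow> x * g ^ n = x"
proof -
  have "\<not> inj (\<lambda>n::nat. g ^ n)"
    using finite_imageD[of "\<lambda>n::nat. g ^ n" UNIV] by (auto intro: finite_subset[OF subset_UNIV])
  then obtain i j :: nat where "g ^ i = g ^ j" "i < j" by (metis injI linorder_neqE_nat)
  then obtain n where n: "n > 0" "g ^ (i + n) = g ^ i" by (metis less_imp_add_positive)
  have "x * g ^ n = x" if "x \<in> X" for x
  proof -
    have "x \<in> X #> g ^ i"
      using that permutes_on_power[OF assms] by (simp add: permutes_on_def)
    then obtain y where "x = y * g ^ i" by blast
    then show ?thesis using n(2) by (simp add: mult.assoc flip: power_add)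
  qed
  with n(1) show thesis by (rule that)
qed

section \<open>Stabilization\<close>

locale stabilization =
  fixes \<pi> :: "'m::{monoid_mult,finite} \<Rightarrow> 'n::monoid_mult"
    and below :: "'m \<Rightarrow> 'm \<Rightarrow> bool"  (infix "\<sqsubseteq>" 50)
    and \<omega> :: nat
    and sharp :: "'m \<Rightarrow> 'm"
  assumes proj_one [simp]: "\<pi> 1 = 1"
    and proj_mult [simp]: "\<pi> (p * q) = \<pi> p * \<pi> q"
    and below_refl: "p \<sqsubseteq> p"
    and below_trans: "p \<sqsubseteq> q \<Longrightarrow> q \<sqsubseteq> s \<Longrightarrow> p \<sqsubseteq> s"
    and below_mult_left: "p \<sqsubseteq> q \<Longrightarrow> s * p \<sqsubseteq> s * q"
    and below_mult_right: "p \<sqsubseteq> q \<Longrightarrow> p * s \<sqsubseteq> q * s"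
    and proj_below: "p \<sqsubseteq> q \<Longrightarrow> \<pi> p = \<pi> q"
    and omega_pos: "\<omega> > 0"
    and power_omega_idem: "\<pi> p * \<pi> p = \<pi> p \<Longrightarrow> p ^ \<omega> * p ^ \<omega> = p ^ \<omega>"
    and power_below_sharp: "\<pi> p * \<pi> p = \<pi> p \<Longrightarrow> p ^ \<omega> \<sqsubseteq> sharp p"
    and power_Suc_below_sharp: "\<pi> p * \<pi> p = \<pi> p \<Longrightarrow> p ^ Suc \<omega> \<sqsubseteq> sharp p"
    and sharp_mult_power: "\<pi> p * \<pi> p = \<pi> p \<Longrightarrow> sharp p * p ^ \<omega> = sharp p"
    and sharp_one: "sharp 1 = 1"
begin

inductive_set sharp_closure :: "'m set \<Rightarrow> 'm set" for B where
  one: "1 \<in> sharp_closure B"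
| gen: "b \<in> B \<Longrightarrow> b \<in> sharp_closure B"
| mult: "p \<in> sharp_closure B \<Longrightarrow> q \<in> sharp_closure B \<Longrightarrow> p * q \<in> sharp_closure B"
| sharp: "p \<in> sharp_closure B \<Longrightarrow> \<pi> p * \<pi> p = \<pi> p \<Longrightarrow> sharp p \<in> sharp_closure B"

lemma sharp_closure_least:
  assumes "A \<subseteq> sharp_closure B"
  shows "sharp_closure A \<subseteq> sharp_closure B"
proof
  fix p assume "p \<in> sharp_closure A"
  then show "p \<in> sharp_closure B"
    by induction (use assms in \<open>blast intro: sharp_closure.intros\<close>)+
qed

lemma sharp_closure_mono: "A \<subseteq> B \<Longrightarrow> sharp_closure A \<subseteq> sharp_closure B"
  by (rule sharp_closure_least) (auto intro: sharp_closure.gen)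

lemma sharp_closure_power: "p \<in> sharp_closure B \<Longrightarrow> p ^ n \<in> sharp_closure B"
  by (induction n) (auto intro: sharp_closure.intros)

lemma sharp_closure_prod_list: "w \<in> lists B \<Longrightarrow> prod_list w \<in> sharp_closure B"
  by (induction w) (auto intro: sharp_closure.intros)

lemma sharp_mem_left_ideal:
  assumes factor: "p = q * c" and mem: "p \<in> sharp_closure B" and idem: "\<pi> p * \<pi> p = \<pi> p"
    and "q \<in> sharp_closure B"
  shows "sharp p \<in> sharp_closure B #> c"
proof -
  have "p ^ \<omega> = p ^ (\<omega> - 1) * q * c"
    using omega_pos factor by (metis Suc_diff_1 power_Suc2 mult.assoc)
  then have "sharp p = (sharp p * (p ^ (\<omega> - 1) * q)) * c"
    using sharp_mult_power[OF idem] by (simp add: mult.assoc)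
  moreover have "sharp p * (p ^ (\<omega> - 1) * q) \<in> sharp_closure B"
    by (intro sharp_closure.mult sharp_closure.sharp sharp_closure_power mem idem assms(4))
  ultimately show ?thesis by blast
qed

lemma sharp_closure_left_ideal:
  assumes c_mem: "c \<in> sharp_closure B" and A_subset: "A \<subseteq> sharp_closure B #> c"
  shows "sharp_closure A \<subseteq> insert 1 (sharp_closure B #> c)"
proof
  fix p assume "p \<in> sharp_closure A"
  then show "p \<in> insert 1 (sharp_closure B #> c)"
  proof induction
    case one
    then show ?case by simp
  next
    case (gen b)
    then show ?case using A_subset by blast
  next
    case (mult p q)
    then consider "p = 1" | "q = 1"
      | p' q' where "p = p' * c" "q = q' * c" "p' \<in> sharp_closure B" "q' \<in> sharp_closure B"
      by blast
    then show ?case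
    proof cases
      case 3
      then have "p * q = (p' * c * q') * c" "p' * c * q' \<in> sharp_closure B"
        using c_mem by (simp_all add: mult.assoc sharp_closure.mult)
      then show ?thesis by blast
    qed (use mult in simp_all)
  next
    case (sharp p)
    then consider "p = 1" | q where "p = q * c" "q \<in> sharp_closure B" by blast
    then show ?case
    proof cases
      case 2
      then have "p \<in> sharp_closure B" using c_mem by (simp add: sharp_closure.mult)
      then show ?thesis using sharp_mem_left_ideal 2 sharp.hyps(2) by blast
    qed (simp add: sharp_one)
  qed
qed

definition dominated_on :: "'m set \<Rightarrow> 'm \<Rightarrow> 'm \<Rightarrow> bool" where
  "dominated_on X p q \<longleftrightarrow> (\<forall>x\<in>X. x * p \<sqsubseteq> x * q)"

lemma dominated_on_refl: "dominated_on X p p"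
  by (simp add: dominated_on_def below_refl)

lemma dominated_on_trans: "dominated_on X p q \<Longrightarrow> dominated_on X q s \<Longrightarrow> dominated_on X p s"
  unfolding dominated_on_def by (blast intro: below_trans)

lemma dominated_on_subset: "Y \<subseteq> X \<Longrightarrow> dominated_on X p q \<Longrightarrow> dominated_on Y p q"
  unfolding dominated_on_def by blast

lemma dominated_on_UNIV: "dominated_on UNIV p q \<longleftrightarrow> p \<sqsubseteq> q"
  unfolding dominated_on_def by (metis UNIV_I below_mult_left mult_1)

lemma dominated_on_mult:
  assumes "dominated_on X p p'" and "dominated_on Y q q'" and "\<And>x. x \<in> X \<Longrightarrow> x * p' \<in> Y"
  shows "dominated_on X (p * q) (p' * q')"
  unfolding dominated_on_def
proof
  fix x assume "x \<in> X"
  then have "x * p * q \<sqsubseteq> x * p' * q" "x * p' * q \<sqsubseteq> x * p' * q'"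
    using assms below_mult_right by (auto simp: dominated_on_def)
  then show "x * (p * q) \<sqsubseteq> x * (p' * q')" by (simp add: mult.assoc below_trans)
qed

definition same_action :: "'m set \<Rightarrow> 'm \<Rightarrow> 'm \<Rightarrow> bool" where
  "same_action X p q \<longleftrightarrow> (\<forall>x\<in>X. \<pi> x * \<pi> p = \<pi> x * \<pi> q)"

lemma same_action_sym: "same_action X p q \<Longrightarrow> same_action X q p"
  and same_action_trans: "same_action X p q \<Longrightarrow> same_action X q s \<Longrightarrow> same_action X p s"
  and same_action_subset: "Y \<subseteq> X \<Longrightarrow> same_action X p q \<Longrightarrow> same_action Y p q"
  unfolding same_action_def by auto

lemma dominated_on_same_action: "dominated_on X p q \<Longrightarrow> same_action X p q"
  unfolding dominated_on_def same_action_def by (metis proj_below proj_mult)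

definition invariant_under :: "'m set \<Rightarrow> 'm set \<Rightarrow> bool" where
  "invariant_under B X \<longleftrightarrow> (\<forall>x\<in>X. \<forall>p\<in>sharp_closure B. x * p \<in> X)"

lemma invariant_underD: "invariant_under B X \<Longrightarrow> x \<in> X \<Longrightarrow> p \<in> sharp_closure B \<Longrightarrow> x * p \<in> X"
  by (simp add: invariant_under_def)

text \<open>Aperiodicity of the projection of an element can be tested on \<open>X\<close>. This is what remains of
  \<open>1 \<in> X\<close> when \<open>X\<close> shrinks to \<open>X #> c\<close>.\<close>

definition detects_aperiodic :: "'m set \<Rightarrow> 'm set \<Rightarrow> bool" where
  "detects_aperiodic B X \<longleftrightarrow> (\<forall>p\<in>sharp_closure B.
     (\<exists>k. same_action X (p ^ Suc k) (p ^ k)) \<longrightarrow> (\<exists>k. \<pi> (p ^ Suc k) = \<pi> (p ^ k)))"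

definition action_langs :: "'m set \<Rightarrow> 'm list set set" where
  "action_langs X = {L. \<forall>v w. same_action X (prod_list v) (prod_list w) \<longrightarrow> (v \<in> L \<longleftrightarrow> w \<in> L)}"

lemma empty_action_langs: "{} \<in> action_langs X"
  by (simp add: action_langs_def)

lemma action_class_action_langs:
  assumes "Y \<subseteq> X"
  shows "{w. \<exists>v\<in>L. same_action Y (prod_list v) (prod_list w)} \<in> action_langs X"
  unfolding action_langs_def
  using same_action_subset[OF assms] same_action_trans same_action_sym by blast

definition dominated_cover :: "'m set \<Rightarrow> 'm set \<Rightarrow> bool" where
  "dominated_cover B X \<longleftrightarrow> (\<exists>KK. is_D_cover (SF (action_langs X)) (lists B) KK \<and>
     (\<forall>K\<in>KK. \<exists>p\<in>sharp_closure B. \<forall>w\<in>K. dominated_on X (prod_list w) p))"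

subsection \<open>Elements acting as permutations\<close>

lemma dominated_on_sharp:
  assumes "permutes_on X s" and idem: "\<pi> s * \<pi> s = \<pi> s"
  shows "dominated_on X 1 (sharp s)" and "dominated_on X s (sharp s)"
proof -
  have fixed: "x * s ^ \<omega> = x" if "x \<in> X" for x
    using permutes_on_idempotent[OF permutes_on_power[OF assms(1)] power_omega_idem[OF idem] that] .
  show "dominated_on X 1 (sharp s)"
    unfolding dominated_on_def
    using fixed below_mult_left[OF power_below_sharp[OF idem]] by (metis mult_1_right)
  have "x * s ^ Suc \<omega> = x * s" if "x \<in> X" for x
    unfolding power_Suc2 mult.assoc[symmetric] fixed[OF that] ..
  then show "dominated_on X s (sharp s)"
    unfolding dominated_on_def using below_mult_left[OF power_Suc_below_sharp[OF idem]] by metis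
qed

lemma trivially_acting_bound:
  assumes "detects_aperiodic B X" and u: "u \<in> sharp_closure B" "permutes_on X u" "same_action X u 1"
  shows "\<exists>h\<in>sharp_closure B. dominated_on X 1 h \<and> dominated_on X u h"
proof -
  have "same_action X (u ^ Suc 0) (u ^ 0)" using u(3) by simp
  then obtain k where k: "\<pi> (u ^ Suc k) = \<pi> (u ^ k)"
    using assms(1) u(1) unfolding detects_aperiodic_def by blast
  have stable: "\<pi> (u ^ m) = \<pi> (u ^ k)" if "k \<le> m" for m
    using that
  proof (induction m rule: dec_induct)
    case (step m)
    then show ?case using k by simp
  qed simp
  obtain n where n: "n > 0" "\<And>x. x \<in> X \<Longrightarrow> x * u ^ n = x"
    using permutes_on_power_eq_id[OF u(2)] by blast
  \<comment> \<open>\<open>s\<close> acts on \<open>X\<close> like \<open>u\<close>, but in addition its projection is idempotent.\<close>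
  define s where "s = u ^ Suc (n * k)"
  have "k \<le> Suc (n * k)" using n(1) by (cases n) auto
  then have idem: "\<pi> s * \<pi> s = \<pi> s"
    unfolding s_def proj_mult[symmetric] power_add[symmetric] by (metis stable trans_le_add1)
  have "permutes_on X s" unfolding s_def by (rule permutes_on_power[OF u(2)])
  note s = dominated_on_sharp[OF this idem]
  have "x * s = x * u" if "x \<in> X" for x
  proof -
    have "x * (u ^ n) ^ k = x"
      by (induction k) (simp_all add: n(2)[OF that] power_Suc2 flip: mult.assoc power_Suc)
    then show ?thesis by (simp only: s_def power_Suc2 power_mult flip: mult.assoc)
  qed
  then have "dominated_on X u (sharp s)" using s(2) by (simp add: dominated_on_def)
  moreover have "s \<in> sharp_closure B" unfolding s_def by (rule sharp_closure_power[OF u(1)])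
  then have "sharp s \<in> sharp_closure B" using idem by (rule sharp_closure.sharp)
  ultimately show ?thesis using s(1) by blast
qed

lemma trivially_acting_joint_bound:
  assumes "invariant_under B X" and "detects_aperiodic B X"
    and trivial: "\<And>h. h \<in> H \<Longrightarrow> h \<in> sharp_closure B \<and> permutes_on X h \<and> same_action X h 1"
  shows "\<exists>z\<in>sharp_closure B. \<forall>h\<in>insert 1 H. dominated_on X h z"
  using finite[of H] trivial
proof (induction H)
  case empty
  show ?case by (intro bexI[of _ 1]) (simp_all add: dominated_on_refl sharp_closure.one)
next
  case (insert u H)
  then obtain z where z: "z \<in> sharp_closure B" "\<forall>h\<in>insert 1 H. dominated_on X h z" by blast
  have "u \<in> sharp_closure B" "permutes_on X u" "same_action X u 1" using insert.prems by simp_all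
  from trivially_acting_bound[OF assms(2) this]
  obtain g where g: "g \<in> sharp_closure B" "dominated_on X 1 g" "dominated_on X u g" by blast
  note compose = dominated_on_mult[OF _ _ invariant_underD[OF assms(1) _ g(1)]]
  have "dominated_on X h (g * z)" if "h \<in> insert 1 (insert u H)" for h
    using that compose[OF g(2), of h z] compose[OF g(3), of 1 z] z(2) by auto
  then show ?case using sharp_closure.mult[OF g(1) z(1)] by blast
qed

lemma permuting_joint_bound:
  assumes "invariant_under B X" and "detects_aperiodic B X"
    and permuting: "\<And>g. g \<in> G \<Longrightarrow> g \<in> sharp_closure B \<and> permutes_on X g"
    and same: "\<And>g h. g \<in> G \<Longrightarrow> h \<in> G \<Longrightarrow> same_action X g h"
  shows "\<exists>p\<in>sharp_closure B. \<forall>g\<in>G. dominated_on X g p"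
proof (cases "G = {}")
  case True
  then show ?thesis using sharp_closure.one by blast
next
  case False
  then obtain g where g: "g \<in> G" "g \<in> sharp_closure B" "permutes_on X g" using permuting by blast
  obtain n where n: "n > 0" "\<And>x. x \<in> X \<Longrightarrow> x * g ^ n = x"
    using permutes_on_power_eq_id[OF g(3)] by blast
  define g_inv where "g_inv = g ^ (n - 1)"
  have g_inv_mem: "g_inv \<in> sharp_closure B" "permutes_on X g_inv"
    unfolding g_inv_def using g by (auto intro: sharp_closure_power permutes_on_power)
  have cancel: "x * g * g_inv = x" "x * g_inv * g = x" if "x \<in> X" for x
    using n(2)[OF that] n(1) unfolding g_inv_def mult.assoc
    by (metis Suc_diff_1 power_Suc, metis Suc_diff_1 power_Suc2)
  have "same_action X (g_inv * h) 1" if "h \<in> G" for h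
    unfolding same_action_def
  proof
    fix x assume x: "x \<in> X"
    then have "x * g_inv \<in> X" using invariant_underD[OF assms(1) _ g_inv_mem(1)] by blast
    then have "\<pi> (x * g_inv) * \<pi> h = \<pi> (x * g_inv) * \<pi> g"
      using same[OF that g(1)] by (simp only: same_action_def)
    also have "\<dots> = \<pi> x" using cancel(2)[OF x] by (simp flip: proj_mult)
    finally show "\<pi> x * \<pi> (g_inv * h) = \<pi> x * \<pi> 1" by (simp add: mult.assoc)
  qed
  then have "h \<in> sharp_closure B \<and> permutes_on X h \<and> same_action X h 1" if "h \<in> (*) g_inv ` G" for h
    using that permuting g_inv_mem by (auto simp: sharp_closure.mult permutes_on_mult)
  from trivially_acting_joint_bound[OF assms(1,2) this]
  obtain z where z: "z \<in> sharp_closure B" "\<forall>h\<in>insert 1 ((*) g_inv ` G). dominated_on X h z"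
    by blast
  have "dominated_on X h (g * z)" if "h \<in> G" for h
  proof -
    have "dominated_on X (g * (g_inv * h)) (g * z)"
      using dominated_on_mult[OF dominated_on_refl] invariant_underD[OF assms(1) _ g(2)] z(2) that
      by blast
    then show ?thesis by (simp add: dominated_on_def cancel(1) flip: mult.assoc)
  qed
  then show ?thesis using sharp_closure.mult[OF g(2) z(1)] by blast
qed

lemma dominated_cover_permuting:
  assumes "invariant_under B X" and "detects_aperiodic B X"
    and perm: "\<And>b. b \<in> B \<Longrightarrow> permutes_on X b"
  shows "dominated_cover B X"
proof -
  let ?class = "\<lambda>m. {w \<in> lists B. same_action X m (prod_list w)}"
  have "\<exists>p\<in>sharp_closure B. \<forall>w\<in>?class m. dominated_on X (prod_list w) p" for m
  proof -
    have "\<exists>p\<in>sharp_closure B. \<forall>g\<in>prod_list ` ?class m. dominated_on X g p"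
    proof (rule permuting_joint_bound[OF assms(1,2)])
      show "g \<in> sharp_closure B \<and> permutes_on X g" if "g \<in> prod_list ` ?class m" for g
        using that sharp_closure_prod_list permutes_on_prod_list[OF perm] by blast
      show "same_action X g h" if "g \<in> prod_list ` ?class m" "h \<in> prod_list ` ?class m" for g h
        using that by (auto intro: same_action_trans same_action_sym)
    qed
    then show ?thesis by blast
  qed
  moreover have "?class m \<in> SF (action_langs X)" for m
  proof -
    have "{w. same_action X m (prod_list w)} \<in> action_langs X"
      unfolding action_langs_def using same_action_trans same_action_sym by blast
    then have "lists B \<inter> {w. same_action X m (prod_list w)} \<in> SF (action_langs X)"
      by (rule SF_inter[OF SF_lists[OF empty_action_langs] SF_base])
    then show ?thesis by (simp add: Int_def)
  qed
  moreover have "lists B \<subseteq> (\<Union>m. ?class m)" by (auto simp: same_action_def)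
  ultimately show ?thesis
    unfolding dominated_cover_def is_D_cover_def is_cover_def
    by (intro exI[of _ "range ?class"]) auto
qed

subsection \<open>Cutting words at a letter\<close>

context
  fixes B X :: "'m set" and c :: 'm and f :: "'m list \<Rightarrow> 'm"
  assumes invariant: "invariant_under B X" and c_mem: "c \<in> B"
    and label_bound: "\<And>u. u \<in> lists (B - {c}) \<Longrightarrow>
      f u \<in> sharp_closure B \<and> dominated_on X (prod_list u) (f u)"
    and SF_label_fibre: "\<And>p. {u. f u = p} \<in> SF (action_langs X)"
begin

lemma X_mult_c_subset: "X #> c \<subseteq> X"
  using invariant_underD[OF invariant _ sharp_closure.gen[OF c_mem]] by blast

lemma block_labels_subset_sharp_closure: "(\<lambda>u. f u * c) ` lists (B - {c}) \<subseteq> sharp_closure B"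
  using label_bound c_mem by (auto intro: sharp_closure.mult sharp_closure.gen)

lemma block_dominated:
  assumes "u \<in> lists (B - {c})"
  shows "dominated_on X (prod_list u * c) (f u * c)"
  using dominated_on_mult[OF _ dominated_on_refl, of X _ _ X] label_bound[OF assms]
    invariant_underD[OF invariant] by blast

lemma mult_block_label:
  assumes "u \<in> lists (B - {c})" and "x \<in> X"
  shows "x * (f u * c) \<in> X #> c"
  using invariant_underD[OF invariant assms(2)] label_bound[OF assms(1)] by (simp flip: mult.assoc)

lemma delimit_dominated:
  assumes "us \<in> lists (lists (B - {c}))"
  shows "dominated_on (X #> c)
    (prod_list (delimit c us)) (prod_list (map (\<lambda>u. f u * c) us))"
  using assms
proof induction
  case Nil
  show ?case by (simp add: dominated_on_refl)
next
  case (Cons u us)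
  have "dominated_on (X #> c) (prod_list u * c) (f u * c)"
    using dominated_on_subset[OF X_mult_c_subset block_dominated] Cons.hyps(1) .
  moreover have "y * (f u * c) \<in> X #> c" if "y \<in> X #> c" for y
    using mult_block_label Cons.hyps(1) X_mult_c_subset that by blast
  ultimately have "dominated_on (X #> c) ((prod_list u * c) * prod_list (delimit c us))
      ((f u * c) * prod_list (map (\<lambda>u. f u * c) us))"
    by (rule dominated_on_mult[OF _ Cons.IH])
  then show ?case by (simp add: mult.assoc)
qed

lemma SF_label_fibre_lists: "{u \<in> lists A. f u = p} \<in> SF (action_langs X)"
  using SF_inter[OF SF_lists[OF empty_action_langs] SF_label_fibre[of p]] by (simp add: Int_def)

lemma SF_delimit_vimage_action_langs:
  assumes "L \<in> SF (action_langs (X #> c))"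
  shows "delimit_vimage c (B - {c}) (\<lambda>u. f u * c) L
    \<in> SF (action_langs X)"
proof (rule SF_delimit_vimage[OF empty_action_langs _ _ _ assms])
  show "c \<notin> B - {c}" by simp
next
  fix b
  have "{u \<in> lists (B - {c}). f u * c = b} = (\<Union>p\<in>{p. p * c = b}. {u \<in> lists (B - {c}). f u = p})"
    by blast
  then show "{u \<in> lists (B - {c}). f u * c = b} \<in> SF (action_langs X)"
    by (simp only:) (intro SF_UN empty_action_langs SF_label_fibre_lists finite)
next
  let ?Y = "X #> c"
  let ?all = "lists (lists (B - {c}))"
  fix L assume L: "L \<in> action_langs ?Y"
  have "map (\<lambda>u. f u * c) us \<in> L \<longleftrightarrow>
      (\<exists>v\<in>L. same_action ?Y (prod_list v) (prod_list (delimit c us)))" if "us \<in> ?all" for us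
    using L dominated_on_same_action[OF delimit_dominated[OF that]]
      same_action_trans same_action_sym
    unfolding action_langs_def by blast
  then have "delimit_vimage c (B - {c}) (\<lambda>u. f u * c) L =
      delimit c ` ?all \<inter> {w. \<exists>v\<in>L. same_action ?Y (prod_list v) (prod_list w)}"
    by blast
  then show "delimit_vimage c (B - {c}) (\<lambda>u. f u * c) L \<in> SF (action_langs X)"
    by (simp only: SF_inter SF_delimit_image_lists empty_action_langs SF_base
        action_class_action_langs[OF X_mult_c_subset])
qed

definition cut_lang :: "'m \<Rightarrow> 'm list set \<Rightarrow> 'm \<Rightarrow> 'm list set" where
  "cut_lang p L q = conc {u \<in> lists (B - {c}). f u = p} (conc {[c]}
     (conc (delimit_vimage c (B - {c}) (\<lambda>u. f u * c) L)
       {u \<in> lists (B - {c}). f u = q}))"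

lemma SF_cut_lang: "L \<in> SF (action_langs (X #> c)) \<Longrightarrow> cut_lang p L q \<in> SF (action_langs X)"
  unfolding cut_lang_def
  by (intro SF_conc SF_letter SF_label_fibre_lists SF_delimit_vimage_action_langs)

lemma cut_lang_dominated:
  assumes s: "s \<in> sharp_closure B"
    and L: "\<And>v. v \<in> L \<Longrightarrow> dominated_on (X #> c) (prod_list v) s"
    and w: "w \<in> cut_lang p L q"
  shows "dominated_on X (prod_list w) (p * c * s * q)"
proof -
  obtain u us u' where u: "u \<in> lists (B - {c})" "f u = p" and u': "u' \<in> lists (B - {c})" "f u' = q"
    and us: "us \<in> lists (lists (B - {c}))" "map (\<lambda>u. f u * c) us \<in> L"
    and w_eq: "w = u @ [c] @ delimit c us @ u'"
    using w unfolding cut_lang_def conc_def by blast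
  have "dominated_on (X #> c) (prod_list (delimit c us)) s"
    using delimit_dominated[OF us(1)] L[OF us(2)] by (rule dominated_on_trans)
  moreover have "y * s \<in> X" if "y \<in> X #> c" for y
    using invariant_underD[OF invariant _ s] X_mult_c_subset that by blast
  moreover have "dominated_on X (prod_list u') q" using label_bound[OF u'(1)] u'(2) by blast
  ultimately have "dominated_on (X #> c) (prod_list (delimit c us) * prod_list u') (s * q)"
    by (intro dominated_on_mult)
  then have "dominated_on X ((prod_list u * c) * (prod_list (delimit c us) * prod_list u'))
      ((f u * c) * (s * q))"
    by (rule dominated_on_mult[OF block_dominated[OF u(1)] _ mult_block_label[OF u(1)]])
  then show ?thesis by (simp add: w_eq u(2) mult.assoc)
qed

lemma cut_lang_bound:
  assumes "p \<in> sharp_closure B" and "q \<in> sharp_closure B"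
    and "\<exists>s\<in>sharp_closure ((\<lambda>u. f u * c) ` lists (B - {c})).
      \<forall>v\<in>L. dominated_on (X #> c) (prod_list v) s"
  shows "\<exists>r\<in>sharp_closure B. \<forall>w\<in>cut_lang p L q. dominated_on X (prod_list w) r"
proof -
  obtain s where s: "s \<in> sharp_closure ((\<lambda>u. f u * c) ` lists (B - {c}))"
    "\<And>v. v \<in> L \<Longrightarrow> dominated_on (X #> c) (prod_list v) s"
    using assms(3) by blast
  have "s \<in> sharp_closure B"
    using sharp_closure_least[OF block_labels_subset_sharp_closure] s(1) by blast
  then have "p * c * s * q \<in> sharp_closure B"
    using assms(1,2) c_mem by (auto intro: sharp_closure.mult sharp_closure.gen)
  moreover have "\<forall>w\<in>cut_lang p L q. dominated_on X (prod_list w) (p * c * s * q)"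
    using cut_lang_dominated[OF \<open>s \<in> sharp_closure B\<close> s(2)] by blast
  ultimately show ?thesis by blast
qed

lemma lists_cases_cut_lang:
  assumes "w \<in> lists B" and "map (\<lambda>u. f u * c) ` lists (lists (B - {c})) \<subseteq> \<Union>KK"
  obtains "w \<in> lists (B - {c})"
  | p L q where "p \<in> sharp_closure B" "L \<in> KK" "q \<in> sharp_closure B" "w \<in> cut_lang p L q"
proof -
  have "w \<in> lists (insert c (B - {c}))" using assms(1) c_mem by (simp add: insert_absorb)
  then obtain us u' where w: "us \<in> lists (lists (B - {c}))" "u' \<in> lists (B - {c})"
    "w = delimit c us @ u'"
    unfolding lists_insert_eq_conc_delimit conc_def by blast
  show thesis
  proof (cases us)
    case Nil
    then show thesis using that(1) w by simp
  next
    case (Cons u vs)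
    then have vs: "vs \<in> lists (lists (B - {c}))" and u: "u \<in> lists (B - {c})" using w(1) by auto
    obtain L where L: "L \<in> KK" "map (\<lambda>u. f u * c) vs \<in> L" using assms(2) vs by blast
    have "u @ [c] @ delimit c vs @ u' \<in> cut_lang (f u) L (f u')"
      unfolding cut_lang_def by (intro concI) (use u w(2) vs L(2) in auto)
    then show thesis using that(2) label_bound[OF u] label_bound[OF w(2)] L(1) w(3) Cons
      by (metis append_Cons append_Nil append_assoc delimit_Cons)
  qed
qed

lemma dominated_cover_step:
  assumes "dominated_cover ((\<lambda>u. f u * c) ` lists (B - {c})) (X #> c)"
  shows "dominated_cover B X"
proof -
  let ?T = "(\<lambda>u. f u * c) ` lists (B - {c})" and ?Y = "X #> c"
  obtain KK where KK: "finite KK" "KK \<subseteq> SF (action_langs ?Y)" "lists ?T \<subseteq> \<Union>KK"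
    and bound: "\<forall>K\<in>KK. \<exists>s\<in>sharp_closure ?T. \<forall>v\<in>K. dominated_on ?Y (prod_list v) s"
    using assms unfolding dominated_cover_def is_D_cover_def is_cover_def by blast
  let ?W = "sharp_closure B"
  define MM where "MM = (\<lambda>p. {u \<in> lists (B - {c}). f u = p}) ` ?W
    \<union> (\<lambda>(p, L, q). cut_lang p L q) ` (?W \<times> KK \<times> ?W)"
  have "lists B \<subseteq> \<Union>MM"
  proof
    fix w assume "w \<in> lists B"
    moreover have "map (\<lambda>u. f u * c) ` lists (lists (B - {c})) \<subseteq> \<Union>KK"
      using KK(3) by (auto simp: lists_image)
    ultimately show "w \<in> \<Union>MM"
      by (cases rule: lists_cases_cut_lang) (use label_bound in \<open>auto simp: MM_def\<close>)
  qed
  moreover have "MM \<subseteq> SF (action_langs X)"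
    using KK(2) by (auto simp: MM_def intro: SF_label_fibre_lists SF_cut_lang)
  moreover have "finite MM" using KK(1) by (simp add: MM_def)
  moreover have "\<exists>p\<in>?W. \<forall>w\<in>M. dominated_on X (prod_list w) p" if "M \<in> MM" for M
  proof -
    from that consider p where "p \<in> ?W" "M = {u \<in> lists (B - {c}). f u = p}"
      | p L q where "p \<in> ?W" "L \<in> KK" "q \<in> ?W" "M = cut_lang p L q"
      unfolding MM_def by auto
    then show ?thesis
    proof cases
      case 1
      then show ?thesis using label_bound by (intro bexI[of _ p]) auto
    next
      case 2
      then show ?thesis using cut_lang_bound bound by simp
    qed
  qed
  ultimately show ?thesis unfolding dominated_cover_def is_D_cover_def is_cover_def by blast
qed

end

subsection \<open>Existence of dominated covers\<close>

lemma invariant_under_shrink: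
  assumes "invariant_under B X" and c_mem: "c \<in> sharp_closure B"
    and A_subset: "A \<subseteq> sharp_closure B #> c"
  shows "invariant_under A (X #> c)"
  unfolding invariant_under_def
proof (intro ballI)
  fix y p assume y: "y \<in> X #> c" and "p \<in> sharp_closure A"
  then consider "p = 1" | q where "p = q * c" "q \<in> sharp_closure B"
    using sharp_closure_left_ideal[OF c_mem A_subset] by blast
  then show "y * p \<in> X #> c"
  proof cases
    case (2 q)
    have "y * q \<in> X" using y 2(2) c_mem by (auto intro!: invariant_underD[OF assms(1)])
    then show ?thesis using 2(1) by (simp flip: mult.assoc)
  qed (use y in simp)
qed

lemma detects_aperiodic_shrink:
  assumes "invariant_under B X" and "detects_aperiodic B X" and c_mem: "c \<in> sharp_closure B"
    and A_subset: "A \<subseteq> sharp_closure B #> c"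
  shows "detects_aperiodic A (X #> c)"
  unfolding detects_aperiodic_def
proof (intro ballI impI)
  fix p assume p: "p \<in> sharp_closure A"
    and "\<exists>k. same_action (X #> c) (p ^ Suc k) (p ^ k)"
  then obtain k where k: "same_action (X #> c) (p ^ Suc k) (p ^ k)" by blast
  from p consider "p = 1" | q where "p = q * c" "q \<in> sharp_closure B"
    using sharp_closure_left_ideal[OF c_mem A_subset] by blast
  then show "\<exists>k. \<pi> (p ^ Suc k) = \<pi> (p ^ k)"
  proof cases
    case (2 q)
    have "same_action X (p ^ Suc (Suc k)) (p ^ Suc k)"
      unfolding same_action_def
    proof
      fix x assume "x \<in> X"
      then have "x * p \<in> X #> c"
        using invariant_underD[OF assms(1) _ 2(2)] 2(1) by (simp flip: mult.assoc)
      then have "\<pi> (x * p) * \<pi> (p ^ Suc k) = \<pi> (x * p) * \<pi> (p ^ k)"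
        using k unfolding same_action_def by blast
      then show "\<pi> x * \<pi> (p ^ Suc (Suc k)) = \<pi> x * \<pi> (p ^ Suc k)" by (simp add: mult.assoc)
    qed
    moreover have "p \<in> sharp_closure B" using 2 c_mem by (simp add: sharp_closure.mult)
    ultimately show ?thesis using assms(2) unfolding detects_aperiodic_def by blast
  qed simp
qed

lemma dominated_cover_exists:
  assumes "invariant_under B X" and "detects_aperiodic B X"
  shows "dominated_cover B X"
  using assms
proof (induction "(card X, card B)" arbitrary: B X
    rule: wf_induct_rule[OF wf_lex_prod[OF wf_less_than wf_less_than], case_names step])
  case (step B X)
  show ?case
  proof (cases "\<forall>b\<in>B. permutes_on X b")
    case True
    then show ?thesis using dominated_cover_permuting[OF "step.prems"] by blast
  next
    case False
    then obtain c where c_moves: "c \<in> B" "\<not> permutes_on X c" by blast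
    then have c_mem: "c \<in> sharp_closure B" by (blast intro: sharp_closure.gen)
    let ?B' = "B - {c}" and ?Y = "X #> c"
    have closure_subset: "sharp_closure ?B' \<subseteq> sharp_closure B" by (rule sharp_closure_mono) blast
    have "card ?B' < card B" using c_moves(1) by (intro card_Diff1_less) auto
    moreover have "invariant_under ?B' X" "detects_aperiodic ?B' X"
      using "step.prems" closure_subset
      unfolding invariant_under_def detects_aperiodic_def by blast+
    ultimately obtain KK where cover: "is_D_cover (SF (action_langs X)) (lists ?B') KK"
      "\<And>K. K \<in> KK \<Longrightarrow> \<exists>p\<in>sharp_closure ?B'. \<forall>w\<in>K. dominated_on X (prod_list w) p"
      using "step.hyps"[of X ?B'] by (auto simp: dominated_cover_def)
    obtain f where label: "\<And>u. u \<in> lists ?B' \<Longrightarrow>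
        f u \<in> sharp_closure ?B' \<and> dominated_on X (prod_list u) (f u)"
      "\<And>p. {u. f u = p} \<in> SF (action_langs X)"
      using SF_cover_choice[OF empty_action_langs cover] by blast
    let ?T = "(\<lambda>u. f u * c) ` lists ?B'"
    have block_labels: "?T \<subseteq> sharp_closure B #> c" using label(1) closure_subset by blast
    have "invariant_under ?T ?Y" "detects_aperiodic ?T ?Y"
      using "step.prems" invariant_under_shrink[OF _ c_mem block_labels]
        detects_aperiodic_shrink[OF _ _ c_mem block_labels]
      by simp_all
    moreover have "?Y \<subset> X"
      using c_moves(2) invariant_underD[OF "step.prems"(1) _ c_mem]
      unfolding permutes_on_def by blast
    then have "card ?Y < card X" by (simp add: psubset_card_mono)
    ultimately have "dominated_cover ?T ?Y" using "step.hyps"[of ?Y ?T] by simp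
    then show ?thesis
      using dominated_cover_step[OF "step.prems"(1) c_moves(1) _ label(2)] label(1) closure_subset
      by blast
  qed
qed

proposition SF_cover_dominated:
  fixes C :: "'a::finite list set set" and h :: "'a \<Rightarrow> 'm"
  assumes "{} \<in> C" and recognized: "\<And>F. (\<lambda>w. \<pi> (prod_list (map h w))) -` F \<in> C"
  shows "\<exists>KK. is_D_cover (SF C) UNIV KK \<and>
    (\<forall>K\<in>KK. \<exists>p\<in>sharp_closure (range h). \<forall>w\<in>K. prod_list (map h w) \<sqsubseteq> p)"
proof -
  have same_action_UNIV: "same_action UNIV p q \<longleftrightarrow> \<pi> p = \<pi> q" for p q
    unfolding same_action_def by (metis UNIV_I mult_1 proj_one)
  have "invariant_under (range h) UNIV" "detects_aperiodic (range h) UNIV"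
    by (auto simp: invariant_under_def detects_aperiodic_def same_action_UNIV)
  then have "dominated_cover (range h) UNIV" by (rule dominated_cover_exists)
  then obtain KK where KK: "finite KK" "KK \<subseteq> SF (action_langs UNIV)" "lists (range h) \<subseteq> \<Union>KK"
    and bound: "\<forall>K\<in>KK. \<exists>p\<in>sharp_closure (range h). \<forall>w\<in>K. dominated_on UNIV (prod_list w) p"
    unfolding dominated_cover_def is_D_cover_def is_cover_def by blast
  define \<phi> where "\<phi> w = \<pi> (prod_list (map h w))" for w
  have "map h -` L \<in> SF C" if "L \<in> SF (action_langs UNIV)" for L
  proof (rule SF_vimage_map[OF assms(1) _ that])
    fix L assume "L \<in> action_langs UNIV"
    then have "map h v \<in> L \<longleftrightarrow> map h w \<in> L" if "\<phi> v = \<phi> w" for v w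
      using that unfolding action_langs_def same_action_UNIV \<phi>_def by blast
    then have "map h -` L = \<phi> -` (\<phi> ` (map h -` L))" by blast
    then show "map h -` L \<in> SF C" using SF_base[OF recognized] unfolding \<phi>_def by (rule ssubst)
  qed
  moreover have "w \<in> \<Union>((-`) (map h) ` KK)" for w
  proof -
    have "map h w \<in> lists (range h)" by (auto simp: lists_eq_set)
    then show ?thesis using KK(3) by blast
  qed
  ultimately have "is_D_cover (SF C) UNIV ((-`) (map h) ` KK)"
    using KK(1,2) by (auto simp: is_D_cover_def is_cover_def)
  moreover have "\<exists>p\<in>sharp_closure (range h). \<forall>w\<in>map h -` K. prod_list (map h w) \<sqsubseteq> p"
    if "K \<in> KK" for K
    using bound that by (fastforce simp: dominated_on_UNIV)
  ultimately show ?thesis by blast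
qed

end

section \<open>Weights\<close>

instantiation prod :: (monoid_mult, monoid_mult) monoid_mult
begin

definition one_prod_def: "1 = (1, 1)"

definition times_prod_def: "p * q = (fst p * fst q, snd p * snd q)"

instance
  by standard (simp_all add: one_prod_def times_prod_def mult.assoc)

end

lemma fst_one [simp]: "fst 1 = 1" and snd_one [simp]: "snd 1 = 1"
  by (simp_all add: one_prod_def)

lemma fst_times [simp]: "fst (p * q) = fst p * fst q"
  and snd_times [simp]: "snd (p * q) = snd p * snd q"
  by (simp_all add: times_prod_def)

lemma fst_power [simp]: "fst (p ^ n) = fst p ^ n" and snd_power [simp]: "snd (p ^ n) = snd p ^ n"
  by (induction n) simp_all

definition weight_le :: "'n \<times> 'r::plus \<Rightarrow> 'n \<times> 'r \<Rightarrow> bool" where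
  "weight_le p q \<longleftrightarrow> fst p = fst q \<and> rle (snd p) (snd q)"

definition weight_sharp :: "nat \<Rightarrow> 'n \<times> 'r::{semiring_0,monoid_mult} \<Rightarrow> 'n \<times> 'r" where
  "weight_sharp \<omega> p = (fst p, snd p ^ \<omega> + snd p ^ (\<omega> + 1))"

lemma idempotent_power_eq:
  fixes e :: "'m::monoid_mult"
  assumes "e * e = e" and "n > 0"
  shows "e ^ n = e"
  using assms(2) by (induction n rule: nat_induct_non_zero) (simp_all add: assms(1))

lemma stabilization_weights:
  assumes add_idem: "\<And>r::'r::{semiring_0,monoid_mult,finite}. r + r = r"
    and "\<omega> > 0" and omega_idem: "\<And>r::'r. r ^ \<omega> * r ^ \<omega> = r ^ \<omega>"
  shows "stabilization (fst :: 'n::{monoid_mult,finite} \<times> 'r \<Rightarrow> 'n) weight_le \<omega> (weight_sharp \<omega>)"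
proof
  fix p q s :: "'n \<times> 'r"
  show "weight_le p p" by (simp add: weight_le_def rle_def add_idem)
  show "weight_le p q \<Longrightarrow> weight_le q s \<Longrightarrow> weight_le p s"
    unfolding weight_le_def by (metis rle_trans)
  show "weight_le p q \<Longrightarrow> weight_le (s * p) (s * q)" "weight_le p q \<Longrightarrow> weight_le (p * s) (q * s)"
    by (simp_all add: weight_le_def rle_def flip: distrib_left distrib_right)
  show "weight_le p q \<Longrightarrow> fst p = fst q" by (simp add: weight_le_def)
  show "weight_sharp \<omega> 1 = (1 :: 'n \<times> 'r)"
    by (simp add: weight_sharp_def one_prod_def add_idem)
  assume idem: "fst p * fst p = fst p"
  then have fst_power_omega: "fst p ^ \<omega> = fst p" using idempotent_power_eq \<open>\<omega> > 0\<close> by blast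
  show "p ^ \<omega> * p ^ \<omega> = p ^ \<omega>"
    by (rule prod_eqI) (simp_all add: fst_power_omega idem omega_idem)
  show "weight_le (p ^ \<omega>) (weight_sharp \<omega> p)" "weight_le (p ^ Suc \<omega>) (weight_sharp \<omega> p)"
    by (simp_all add: weight_le_def weight_sharp_def rle_def fst_power_omega idem add_idem
        add.left_commute flip: add.assoc)
  show "weight_sharp \<omega> p * p ^ \<omega> = weight_sharp \<omega> p"
    by (rule prod_eqI)
      (simp_all add: weight_sharp_def fst_power_omega idem distrib_right omega_idem mult.assoc)
qed (simp_all add: \<open>\<omega> > 0\<close>)

lemma prod_list_letter_weights:
  fixes \<eta> :: "'a list \<Rightarrow> 'n::monoid_mult"
  assumes "monoid_morphism \<eta>" and "multiplicative_rating_map \<rho>"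
  shows "prod_list (map (\<lambda>a. (\<eta> [a], \<rho> {[a]})) w) = (\<eta> w, \<rho> {w})"
proof (induction w)
  case Nil
  then show ?case
    using assms by (simp add: monoid_morphism_def multiplicative_rating_map_def one_prod_def)
next
  case (Cons a w)
  have "\<eta> (a # w) = \<eta> [a] * \<eta> w"
    using assms(1) by (metis append_Cons append_Nil monoid_morphism_def)
  moreover have "conc {[a]} {w} = {a # w}" by (simp add: conc_def)
  then have "\<rho> {a # w} = \<rho> {[a]} * \<rho> {w}" using assms(2) by (metis multiplicative_rating_map_def)
  ultimately show ?case using Cons by (simp add: times_prod_def)
qed

section \<open>Minimality of the optimal imprints\<close>

lemma sharp_closure_subset_saturated:
  fixes \<eta> :: "'a list \<Rightarrow> 'n::{monoid_mult,finite}"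
    and \<rho> :: "'a list set \<Rightarrow> 'r::{semiring_0,monoid_mult,finite}"
  assumes "stabilization (fst :: 'n \<times> 'r \<Rightarrow> 'n) weight_le \<omega> (weight_sharp \<omega>)"
    and \<eta>: "monoid_morphism \<eta>" and \<rho>: "multiplicative_rating_map \<rho>"
    and saturated: "SF_saturated \<eta> \<rho> \<omega> S" and "B \<subseteq> S"
  shows "stabilization.sharp_closure fst (weight_sharp \<omega>) B \<subseteq> S"
proof
  interpret stabilization "fst :: 'n \<times> 'r \<Rightarrow> 'n" weight_le \<omega> "weight_sharp \<omega>" by (rule assms(1))
  fix p assume "p \<in> sharp_closure B"
  then show "p \<in> S"
  proof induction
    case one
    have "(\<eta> [], \<rho> {[]}) \<in> S" using saturated by (simp add: SF_saturated_def)
    then show ?case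
      using \<eta> \<rho> by (simp add: monoid_morphism_def multiplicative_rating_map_def one_prod_def)
  next
    case (gen b)
    then show ?case using assms(5) by blast
  next
    case (mult p q)
    then show ?case
      using saturated unfolding SF_saturated_def times_prod_def by (metis prod.collapse)
  next
    case (sharp p)
    then show ?case
      using saturated unfolding SF_saturated_def weight_sharp_def by (metis prod.collapse)
  qed
qed

lemma opt_imprint_subset_saturated:
  fixes C :: "'a::finite list set set"
    and \<eta> :: "'a list \<Rightarrow> 'n::{monoid_mult,finite}"
    and \<rho> :: "'a list set \<Rightarrow> 'r::{semiring_0,monoid_mult,finite}"
  assumes "{} \<in> C"
    and \<eta>: "C_morphism C \<eta>"
    and \<rho>: "multiplicative_rating_map \<rho>" "nice \<rho>"
    and \<omega>: "\<omega> > 0" "\<forall>r::'r. r ^ \<omega> * r ^ \<omega> = r ^ \<omega>"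
    and saturated: "SF_saturated \<eta> \<rho> \<omega> S"
  shows "{(t, r). r \<in> opt_imprint (SF C) (\<eta> -` {t}) \<rho>} \<subseteq> S"
proof clarify
  fix t r assume r: "r \<in> opt_imprint (SF C) (\<eta> -` {t}) \<rho>"
  have rating: "rating_map \<rho>" and morphism: "monoid_morphism \<eta>" and fibre: "\<eta> -` F \<in> C" for F
    using \<rho> \<eta> by (auto simp: multiplicative_rating_map_def C_morphism_def)
  interpret stabilization "fst :: 'n \<times> 'r \<Rightarrow> 'n" weight_le \<omega> "weight_sharp \<omega>"
    using rating \<omega> by (intro stabilization_weights) (auto simp: rating_map_def)
  let ?h = "\<lambda>a. (\<eta> [a], \<rho> {[a]})"
  note weight = prod_list_letter_weights[OF morphism \<rho>(1)]
  obtain KK where KK: "is_D_cover (SF C) UNIV KK"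
    and bound: "\<And>K. K \<in> KK \<Longrightarrow> \<exists>p\<in>sharp_closure (range ?h). \<forall>w\<in>K. weight_le (\<eta> w, \<rho> {w}) p"
    using SF_cover_dominated[OF assms(1), of ?h] fibre unfolding weight by auto
  have "is_D_cover (SF C) (\<eta> -` {t}) {K \<in> KK. K \<inter> \<eta> -` {t} \<noteq> {}}"
  proof -
    have "\<eta> -` {t} \<subseteq> \<Union>KK" using KK unfolding is_D_cover_def is_cover_def by blast
    then have "\<eta> -` {t} \<subseteq> \<Union>{K \<in> KK. K \<inter> \<eta> -` {t} \<noteq> {}}" by blast
    then show ?thesis using KK by (auto simp: is_D_cover_def is_cover_def)
  qed
  then have "r \<in> imprint \<rho> {K \<in> KK. K \<inter> \<eta> -` {t} \<noteq> {}}"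
    using r opt_imprint_iff[OF lattice_SF[OF assms(1)] rating] by blast
  then obtain K v where K: "K \<in> KK" "rle r (\<rho> K)" and v: "v \<in> K" "\<eta> v = t"
    by (auto simp: imprint_def)
  obtain p where p: "p \<in> sharp_closure (range ?h)"
    and K_le: "\<And>w. w \<in> K \<Longrightarrow> weight_le (\<eta> w, \<rho> {w}) p"
    using bound[OF K(1)] by blast
  have "rle (\<rho> K) (snd p)"
    using nice_rating_le[OF rating \<rho>(2)] K_le by (simp add: weight_le_def)
  then have "rle r (snd p)" by (rule rle_trans[OF K(2)])
  moreover have "fst p = t" using K_le[OF v(1)] v(2) by (simp add: weight_le_def)
  moreover have "range ?h \<subseteq> S" using saturated by (auto simp: SF_saturated_def)
  then have "p \<in> S"
    using sharp_closure_subset_saturated[OF stabilization_axioms morphism \<rho>(1) saturated] p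
    by blast
  ultimately show "(t, r) \<in> S"
    using saturated unfolding SF_saturated_def by (metis prod.collapse)
qed

theorem theorem9p3:
  fixes C :: "'a::finite list set set"
    and \<eta> :: "'a list \<Rightarrow> 'n::{monoid_mult,finite}"
    and \<rho> :: "'a list set \<Rightarrow> 'r::{semiring_0,monoid_mult,finite}"
    and \<omega> :: nat
  assumes "prevariety C" and "finite C"
    and "canonical_C_morphism C \<eta>"
    and "multiplicative_rating_map \<rho>" and "nice \<rho>"
    and "\<omega> > 0" and "\<forall>r::'r. r ^ \<omega> * r ^ \<omega> = r ^ \<omega>"
  shows "least_SF_saturated \<eta> \<rho> \<omega> {(t, r). r \<in> opt_imprint (SF C) (\<eta> -` {t}) \<rho>}"
proof -
  have "{} \<in> C" using assms(1) by (simp add: prevariety_def lattice_def)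
  moreover have "C_morphism C \<eta>" using assms(3) by (simp add: canonical_C_morphism_def)
  ultimately have "{(t, r). r \<in> opt_imprint (SF C) (\<eta> -` {t}) \<rho>} \<subseteq> S"
    if "SF_saturated \<eta> \<rho> \<omega> S" for S
    using opt_imprint_subset_saturated assms(4-7) that by blast
  then show ?thesis
    unfolding least_SF_saturated_def
    using SF_saturated_opt_imprint[OF assms(1-4,6,7)] by blast
qed

end
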